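(* Let $(\mathcal L,(\cdot,\cdot),\mathcal H)\in\mathcal T$ with root system $R$, with the form normalized so that $(\alpha_0,\alpha_0)=1$ for some $\alpha_0\in R^\times$. Let $\mathcal V_{\mathbb Q}=\mathrm{span}_{\mathbb Q}(R)\subseteq\mathcal H^\star$, $\mathcal V=\mathbb R\otimes_{\mathbb Q}\mathcal V_{\mathbb Q}$, and let $(\cdot,\cdot)_{\mathbb R}$ be the real bilinear form on $\mathcal V$ obtained by extending scalars from the (rational-valued) restriction of $(\cdot,\cdot)$ to $\mathcal V_{\mathbb Q}$; identify $\mathcal V_{\mathbb Q}$ with $1\otimes\mathcal V_{\mathbb Q}\subseteq\mathcal V$. Then $\mathcal V$ is finite-dimensional, $(\cdot,\cdot)_{\mathbb R}$ is positive semidefinite, and $(R,(\cdot,\cdot)_{\mathbb R})$ is an extended affine root system in $\mathcal V$.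
   Context: $\mathbb F$ is a field of characteristic $0$. If $V$ is a finite-dimensional space with a non-degenerate symmetric bilinear form and $\alpha\in V^\star$, $t_\alpha$ denotes the unique element of $V$ with $(t_\alpha,v)=\alpha(v)$ for all $v\in V$. A nonzero subalgebra $\mathcal H$ of a Lie algebra $\mathcal L$ is a (split) toral subalgebra if $\mathcal L=\bigoplus_{\alpha\in\mathcal H^\star}\mathcal L_\alpha$, where $\mathcal L_\alpha=\{x\in\mathcal L:[h,x]=\alpha(h)x\ \forall h\in\mathcal H\}$. The class $\mathcal T$ consists of triples $(\mathcal L,(\cdot,\cdot),\mathcal H)$ with: (T1) $\mathcal L$ is a Lie algebra over $\mathbb F$ with a non-degenerate symmetric invariant bilinear form $(\cdot,\cdot)$; (T2) $\mathcal H$ is a finite-dimensional toral subalgebra of $\mathcal L$ and $(\cdot,\cdot)|_{\mathcal H\times\mathcal H}$ is non-degenerate. Put $R=\{\alpha\in\mathcal H^\star:\mathcal L_\alpha\neq0\}$ (root system), transfer the form to $\mathcal H^\star$ by $(\alpha,\beta):=(t_\alpha,t_\beta)$ (with $t_\alpha\in\mathcal H$), and let $R^\times=\{\alpha\in R:(\alpha,\alpha)\ne0\}$, $R^0=\{\alpha\in R:(\alpha,\alpha)=0\}$; (T3) for each $\delta\in R^0$ there are $x\in\mathcal L_\delta$, $y\in\mathcal L_{-\delta}$ with $[x,y]=t_\delta$, and for each $\alpha\in R^\times$ and each $0\ne x\in\mathcal L_\alpha$ there is $y\in\mathcal L_{-\alpha}$ with $[x,y]=t_\alpha$; (T4) for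 $\alpha\in R^\times$ and $x\in\mathcal L_\alpha$, $\mathrm{ad}\,x$ acts locally nilpotently on $\mathcal L$; (T5) (a) $R^\times$ is not a disjoint union of two nonempty subsets orthogonal to each other, (b) for each $\delta\in R^0$ there is $\alpha\in R^\times$ with $\alpha+\delta\in R$; (T6) $\Lambda:=\mathrm{span}_{\mathbb Z}(R^0)$ is a free abelian group of finite rank. Extended affine root system: let $V$ be a nonzero finite-dimensional real vector space with a positive semidefinite symmetric bilinear form $(\cdot,\cdot)$ and $R\subseteq V$ nonempty; put $R^\times=\{\alpha\in R:(\alpha,\alpha)\neq0\}$, $R^0=\{\alpha\in R:(\alpha,\alpha)=0\}$. $R$ is an extended affine root system in $V$ if: (R1) $R=-R$; (R2) $R$ spans $V$; (R3) $R$ is discrete in $V$; (R4) for $\alpha\in R^\times$, $\beta\in R$ there are $d,u\in\mathbb Z_{\ge0}$ with $\{\beta+n\alpha:n\in\mathbb Z\}\cap R=\{\beta-d\alpha,\dots,\beta+u\alpha\}$ and $d-u=2(\beta,\alpha)/(\alpha,\alpha)$; (R5) (a) $R^\times$ is not a disjoint union of two nonempty mutually orthogonal subsets, (b) for each $\delta\in R^0$ there is $\alpha\in R^\times$ with $\alpha+\delta\in R$. *)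

theory Defs
  imports "HOL-Analysis.Analysis"
begin

text \<open>The Lie algebra L is the whole type 'l, a vector space over the field 'a
  via smul; br is the bracket, B the bilinear form, H the toral subalgebra.
  Elements of the dual of H are represented as functions 'l => 'a which are
  linear on H and vanish outside H (so that they are canonical).\<close>

definition lie_algebra :: "('a::field \<Rightarrow> 'l::ab_group_add \<Rightarrow> 'l) \<Rightarrow> ('l \<Rightarrow> 'l \<Rightarrow> 'l) \<Rightarrow> bool" where
  "lie_algebra smul br \<longleftrightarrow> vector_space smul
     \<and> (\<forall>x y z. br (x + y) z = br x z + br y z)
     \<and> (\<forall>x y z. br x (y + z) = br x y + br x z)
     \<and> (\<forall>c x y. br (smul c x) y = smul c (br x y))
     \<and> (\<forall>c x y. br x (smul c y) = smul c (br x y))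
     \<and> (\<forall>x. br x x = 0)
     \<and> (\<forall>x y z. br x (br y z) + br y (br z x) + br z (br x y) = 0)"

definition invariant_nondeg_form ::
  "('a::field \<Rightarrow> 'l::ab_group_add \<Rightarrow> 'l) \<Rightarrow> ('l \<Rightarrow> 'l \<Rightarrow> 'l) \<Rightarrow> ('l \<Rightarrow> 'l \<Rightarrow> 'a) \<Rightarrow> bool" where
  "invariant_nondeg_form smul br B \<longleftrightarrow>
       (\<forall>x y z. B (x + y) z = B x z + B y z)
     \<and> (\<forall>c x y. B (smul c x) y = c * B x y)
     \<and> (\<forall>x y. B x y = B y x)
     \<and> (\<forall>x y z. B (br x y) z = B x (br y z))
     \<and> (\<forall>x. (\<forall>y. B x y = 0) \<longrightarrow> x = 0)"

definition Hdual :: "('a::field \<Rightarrow> 'l::ab_group_add \<Rightarrow> 'l) \<Rightarrow> 'l set \<Rightarrow> ('l \<Rightarrow> 'a) set" where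
  "Hdual smul H = {\<alpha>. (\<forall>x\<in>H. \<forall>y\<in>H. \<alpha> (x + y) = \<alpha> x + \<alpha> y)
                       \<and> (\<forall>c. \<forall>x\<in>H. \<alpha> (smul c x) = c * \<alpha> x)
                       \<and> (\<forall>x. x \<notin> H \<longrightarrow> \<alpha> x = 0)}"

definition rootspace :: "('a::field \<Rightarrow> 'l::ab_group_add \<Rightarrow> 'l) \<Rightarrow> ('l \<Rightarrow> 'l \<Rightarrow> 'l) \<Rightarrow> 'l set \<Rightarrow> ('l \<Rightarrow> 'a) \<Rightarrow> 'l set" where
  "rootspace smul br H \<alpha> = {x. \<forall>h\<in>H. br h x = smul (\<alpha> h) x}"

definition toral :: "('a::field \<Rightarrow> 'l::ab_group_add \<Rightarrow> 'l) \<Rightarrow> ('l \<Rightarrow> 'l \<Rightarrow> 'l) \<Rightarrow> 'l set \<Rightarrow> bool" where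
  "toral smul br H \<longleftrightarrow> H \<noteq> {0} \<and> module.subspace smul H
     \<and> (\<forall>h\<in>H. \<forall>h'\<in>H. br h h' \<in> H)
     \<and> (\<forall>x. \<exists>S f. finite S \<and> S \<subseteq> Hdual smul H
              \<and> (\<forall>\<alpha>\<in>S. f \<alpha> \<in> rootspace smul br H \<alpha>) \<and> x = (\<Sum>\<alpha>\<in>S. f \<alpha>))"

definition roots :: "('a::field \<Rightarrow> 'l::ab_group_add \<Rightarrow> 'l) \<Rightarrow> ('l \<Rightarrow> 'l \<Rightarrow> 'l) \<Rightarrow> 'l set \<Rightarrow> ('l \<Rightarrow> 'a) set" where
  "roots smul br H = {\<alpha> \<in> Hdual smul H. rootspace smul br H \<alpha> \<noteq> {0}}"

definition tvec :: "('l \<Rightarrow> 'l \<Rightarrow> 'a) \<Rightarrow> 'l set \<Rightarrow> ('l \<Rightarrow> 'a) \<Rightarrow> 'l" where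
  "tvec B H \<alpha> = (THE t. t \<in> H \<and> (\<forall>h\<in>H. B t h = \<alpha> h))"

definition hform :: "('l \<Rightarrow> 'l \<Rightarrow> 'a) \<Rightarrow> 'l set \<Rightarrow> ('l \<Rightarrow> 'a) \<Rightarrow> ('l \<Rightarrow> 'a) \<Rightarrow> 'a" where
  "hform B H \<alpha> \<beta> = B (tvec B H \<alpha>) (tvec B H \<beta>)"

definition rootsx :: "('a::field \<Rightarrow> 'l::ab_group_add \<Rightarrow> 'l) \<Rightarrow> ('l \<Rightarrow> 'l \<Rightarrow> 'l) \<Rightarrow> ('l \<Rightarrow> 'l \<Rightarrow> 'a) \<Rightarrow> 'l set \<Rightarrow> ('l \<Rightarrow> 'a) set" where
  "rootsx smul br B H = {\<alpha> \<in> roots smul br H. hform B H \<alpha> \<alpha> \<noteq> 0}"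

definition roots0 :: "('a::field \<Rightarrow> 'l::ab_group_add \<Rightarrow> 'l) \<Rightarrow> ('l \<Rightarrow> 'l \<Rightarrow> 'l) \<Rightarrow> ('l \<Rightarrow> 'l \<Rightarrow> 'a) \<Rightarrow> 'l set \<Rightarrow> ('l \<Rightarrow> 'a) set" where
  "roots0 smul br B H = {\<alpha> \<in> roots smul br H. hform B H \<alpha> \<alpha> = 0}"

definition int_span :: "('l \<Rightarrow> 'a::ring_1) set \<Rightarrow> ('l \<Rightarrow> 'a) set" where
  "int_span X = {(\<lambda>h. \<Sum>b\<in>S. of_int (c b) * b h) | S c. finite S \<and> S \<subseteq> X}"

definition free_abelian_finite_rank :: "('l \<Rightarrow> 'a::ring_1) set \<Rightarrow> bool" where
  "free_abelian_finite_rank G \<longleftrightarrow> (\<exists>Bs. finite Bs \<and> Bs \<subseteq> G \<and> int_span Bs = G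
      \<and> (\<forall>c. (\<lambda>h. \<Sum>b\<in>Bs. of_int (c b) * b h) = (\<lambda>h. 0) \<longrightarrow> (\<forall>b\<in>Bs. c b = 0)))"

definition rat_span :: "('l \<Rightarrow> 'a::field_char_0) set \<Rightarrow> ('l \<Rightarrow> 'a) set" where
  "rat_span X = {(\<lambda>h. \<Sum>b\<in>S. of_rat (c b) * b h) | S c. finite S \<and> S \<subseteq> X}"

definition rat_indep :: "('l \<Rightarrow> 'a::field_char_0) set \<Rightarrow> bool" where
  "rat_indep X \<longleftrightarrow> (\<forall>S c. finite S \<and> S \<subseteq> X \<and> (\<lambda>h. \<Sum>b\<in>S. of_rat (c b) * b h) = (\<lambda>h. 0)
                     \<longrightarrow> (\<forall>b\<in>S. c b = 0))"

definition class_T :: "('a::field_char_0 \<Rightarrow> 'l::ab_group_add \<Rightarrow> 'l) \<Rightarrow> ('l \<Rightarrow> 'l \<Rightarrow> 'l) \<Rightarrow> ('l \<Rightarrow> 'l \<Rightarrow> 'a) \<Rightarrow> 'l set \<Rightarrow> bool" where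
  "class_T smul br B H \<longleftrightarrow>
     \<comment> \<open>(T1)\<close>
     lie_algebra smul br \<and> invariant_nondeg_form smul br B
     \<comment> \<open>(T2)\<close>
   \<and> toral smul br H
   \<and> (\<exists>S. finite S \<and> S \<subseteq> H \<and> module.span smul S = H)
   \<and> (\<forall>h\<in>H. (\<forall>h'\<in>H. B h h' = 0) \<longrightarrow> h = 0)
     \<comment> \<open>(T3)\<close>
   \<and> (\<forall>\<delta>\<in>roots0 smul br B H. \<exists>x\<in>rootspace smul br H \<delta>.
          \<exists>y\<in>rootspace smul br H (\<lambda>h. - \<delta> h). br x y = tvec B H \<delta>)
   \<and> (\<forall>\<alpha>\<in>rootsx smul br B H. \<forall>x\<in>rootspace smul br H \<alpha>. x \<noteq> 0 \<longrightarrow>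
          (\<exists>y\<in>rootspace smul br H (\<lambda>h. - \<alpha> h). br x y = tvec B H \<alpha>))
     \<comment> \<open>(T4)\<close>
   \<and> (\<forall>\<alpha>\<in>rootsx smul br B H. \<forall>x\<in>rootspace smul br H \<alpha>. \<forall>y. \<exists>n. (br x ^^ n) y = 0)
     \<comment> \<open>(T5)\<close>
   \<and> \<not> (\<exists>A C. A \<noteq> {} \<and> C \<noteq> {} \<and> A \<inter> C = {} \<and> A \<union> C = rootsx smul br B H
             \<and> (\<forall>a\<in>A. \<forall>c\<in>C. hform B H a c = 0))
   \<and> (\<forall>\<delta>\<in>roots0 smul br B H. \<exists>\<alpha>\<in>rootsx smul br B H. (\<lambda>h. \<alpha> h + \<delta> h) \<in> roots smul br H)
     \<comment> \<open>(T6)\<close>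
   \<and> free_abelian_finite_rank (int_span (roots0 smul br B H))"

text \<open>A real finite-dimensional space is modelled by a Euclidean-space type 'v
  (with its standard topology, used for discreteness); F is the form.\<close>
definition ears :: "('v::euclidean_space \<Rightarrow> 'v \<Rightarrow> real) \<Rightarrow> 'v set \<Rightarrow> bool" where
  "ears F R \<longleftrightarrow> (UNIV :: 'v set) \<noteq> {0} \<and> bilinear F \<and> (\<forall>u v. F u v = F v u)
     \<and> (\<forall>v. 0 \<le> F v v) \<and> R \<noteq> {}
     \<and> (\<forall>a\<in>R. - a \<in> R)
     \<and> span R = UNIV
     \<and> (\<forall>x\<in>R. \<exists>e>0. \<forall>y\<in>R. y \<noteq> x \<longrightarrow> e \<le> dist y x)
     \<and> (\<forall>\<alpha>\<in>R. F \<alpha> \<alpha> \<noteq> 0 \<longrightarrow> (\<forall>\<beta>\<in>R. \<exists>d u :: nat.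
           {\<beta> + of_int n *\<^sub>R \<alpha> | n. True} \<inter> R
             = {\<beta> + of_int n *\<^sub>R \<alpha> | n. - int d \<le> n \<and> n \<le> int u}
         \<and> real d - real u = 2 * F \<beta> \<alpha> / F \<alpha> \<alpha>))
     \<and> \<not> (\<exists>A C. A \<noteq> {} \<and> C \<noteq> {} \<and> A \<inter> C = {} \<and> A \<union> C = {\<alpha>\<in>R. F \<alpha> \<alpha> \<noteq> 0}
             \<and> (\<forall>a\<in>A. \<forall>c\<in>C. F a c = 0))
     \<and> (\<forall>\<delta>\<in>R. F \<delta> \<delta> = 0 \<longrightarrow> (\<exists>\<alpha>\<in>R. F \<alpha> \<alpha> \<noteq> 0 \<and> \<alpha> + \<delta> \<in> R))"

text \<open>iota : V_Q \<rightarrow> V exhibits V as R \<otimes>_Q V_Q (with V_Q identified with 1 \<otimes> V_Q):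
  iota is Q-linear, its image spans V over R, and it maps Q-independent
  finite sets injectively onto R-independent sets. This is exactly the condition
  that the induced R-linear map R \<otimes>_Q V_Q \<rightarrow> V is an isomorphism.\<close>
definition scalar_extension :: "('l \<Rightarrow> 'a::field_char_0) set \<Rightarrow> (('l \<Rightarrow> 'a) \<Rightarrow> 'v::real_vector) \<Rightarrow> bool" where
  "scalar_extension VQ \<iota> \<longleftrightarrow>
       (\<forall>\<alpha>\<in>VQ. \<forall>\<beta>\<in>VQ. \<iota> (\<lambda>h. \<alpha> h + \<beta> h) = \<iota> \<alpha> + \<iota> \<beta>)
     \<and> (\<forall>q. \<forall>\<alpha>\<in>VQ. \<iota> (\<lambda>h. of_rat q * \<alpha> h) = real_of_rat q *\<^sub>R \<iota> \<alpha>)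
     \<and> span (\<iota> ` VQ) = UNIV
     \<and> (\<forall>S. finite S \<and> S \<subseteq> VQ \<and> rat_indep S \<longrightarrow> inj_on \<iota> S \<and> independent (\<iota> ` S))"

end

theory Submission
  imports Defs "HOL-Library.Function_Algebras"
begin

text \<open>
  Representation theory of \<open>sl\<^sub>2\<close> gives integral Cartan numbers and unbroken descending root
  strings; a Heisenberg pair attached to an isotropic root shows that isotropic roots are orthogonal to
  all roots. From these facts alone, two nonisotropic roots with Cartan numbers \<open>m\<close>, \<open>m'\<close>
  satisfy \<open>0 \<le> m m' \<le> 4\<close>: otherwise the product of the two reflections moves roots so far
  that some root string contains a root with a non-integral Cartan number. Hence, by irreducibility, norms
  are positive rationals, root strings are finite, and modulo isotropic roots there are only finitely many
  roots, so the rational span is finite dimensional. The sum of the squares of the finitely many coroot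
  functionals is invariant under all reflections, hence a positive multiple of the form, which is
  therefore positive semidefinite. The roots lie in finitely many cosets of the lattice spanned by the
  isotropic roots, hence are discrete.
\<close>

section \<open>Combinatorics of root strings\<close>

text \<open>Positivity is part of the conclusion and the ground field carries no order, so
  Cauchy-Schwarz cannot bound the product \<open>t = m * m'\<close> of two Cartan numbers; the bound
  has to come from divisibility. A root \<open>y \<beta> + z \<alpha>\<close> whose Cartan number
  \<open>e\<close> against \<alpha> is 1 or 2 forces the integer
  \<open>X = y^2 m^2 (4 - t) + t e^2\<close> to divide \<open>4 t e\<close>, and for
  \<open>t\<close> outside 0..4 this fails once \<open>y\<close> is large. Two reflections give
  \<open>y = t - 1\<close>, which is too small: for \<open>t = 5\<close>, \<open>m = 1\<close>,
  \<open>e = 2\<close> one gets \<open>X = 4\<close>, a divisor of 40. Four reflections give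
  \<open>y = t^2 - 3 t + 1\<close>, which is enough. Root strings cannot be assumed finite either:
  (T4) kills each vector by some power, without a uniform bound, so the theory of sl_2 only fills
  the stretch between a root and its reflection. Finiteness of strings, rationality of the form and
  finite rational dimension all rest on the bound.\<close>

lemma cartan_product_bound:
  fixes m m' k e y t :: int
  assumes "t = m * m'" "t \<le> -1 \<or> t \<ge> 5" "y = t^2 - 3 * t + 1" "e = 1 \<or> e = 2"
    and eq: "4 * m' * e = k * (4 * y^2 * m + m' * e^2 - y^2 * m^2 * m')"
  shows False
proof -
  \<comment> \<open>Multiplying \<open>eq\<close> by \<open>m\<close> leaves \<open>m'\<close> only
    inside \<open>t\<close>, as \<open>4 * t * e = k * X\<close>. The left side is nonzero, so
    \<open>\<bar>X\<bar>\<close> is at most \<open>8 * \<bar>t\<bar>\<close>, while the factor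
    \<open>y^2\<close> makes it far larger.\<close>
  define X where "X = 4 * y^2 * m^2 + t * e^2 - y^2 * m^2 * t"
  have eq2: "4 * t * e = k * X"
  proof -
    have "4 * t * e = m * (4 * m' * e)" using assms(1) by simp
    also have "\<dots> = k * X" unfolding eq X_def assms(1) by (simp add: algebra_simps power2_eq_square)
    finally show ?thesis .
  qed
  have t0: "t \<noteq> 0" "e \<noteq> 0" using assms by auto
  hence "k \<noteq> 0" using eq2 by auto
  hence "\<bar>X\<bar> \<le> \<bar>k * X\<bar>" using mult_right_mono[of 1 "\<bar>k\<bar>" "\<bar>X\<bar>"] by (simp add: abs_mult)
  hence le: "\<bar>X\<bar> \<le> 8 * \<bar>t\<bar>" using eq2 assms(4) by (auto simp: abs_mult)
  have "m \<noteq> 0" using t0 assms(1) by auto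
  hence m1: "m^2 \<ge> 1" by (simp add: int_one_le_iff_zero_less)
  have Y: "y^2 * m^2 \<ge> y^2" using m1 by (simp add: mult_le_cancel_left1)
  have X: "X = y^2 * m^2 * (4 - t) + t * e^2" by (simp add: X_def algebra_simps)
  from assms(2) show False
  proof
    assume t: "t \<le> -1"
    have "y \<ge> 5"
    proof -
      have "t * t \<ge> 1" using t mult_mono[of 1 "- t" 1 "- t"] by simp
      thus ?thesis using t assms(3) by (simp add: power2_eq_square)
    qed
    hence "y^2 \<ge> 25" using power_mono[of 5 y 2] by simp
    hence "y^2 * m^2 * (4 - t) \<ge> 25 * (4 - t)" using Y t by (intro mult_right_mono) auto
    thus False using le X t assms(4) by auto
  next
    assume t: "t \<ge> 5"
    have "t * t \<ge> 5 * t" using t by (intro mult_right_mono) auto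
    hence "y \<ge> 2 * t + 1" using assms(3) by (simp add: power2_eq_square)
    hence "y^2 \<ge> (2 * t)^2" using t by (intro power_mono) auto
    hence y2: "y^2 \<ge> 20 * t" using \<open>t * t \<ge> 5 * t\<close> by (simp add: power2_eq_square)
    have "y^2 * m^2 * (t - 4) \<ge> 20 * t * 1"
      by (rule mult_mono[OF order_trans[OF y2 Y]]) (use t in auto)
    hence "y^2 * m^2 * (4 - t) \<le> - (20 * t)" by (simp add: algebra_simps)
    thus False using le X t assms(4) by auto
  qed
qed

text \<open>Satisfied both by the vectors \<open>t\<^sub>\<alpha>\<close> over the ground field and by the images of
  the roots in the real scalar extension.\<close>

locale root_datum = vector_space scale
  for scale :: "'k::field_char_0 \<Rightarrow> 'v::ab_group_add \<Rightarrow> 'v" +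
  fixes F :: "'v \<Rightarrow> 'v \<Rightarrow> 'k" and R :: "'v set"
  assumes F_add_left: "F (x + y) z = F x z + F y z"
    and F_scale_left: "F (scale c x) z = c * F x z"
    and F_sym: "F x y = F y x"
    and R_neg: "\<alpha> \<in> R \<Longrightarrow> - \<alpha> \<in> R"
    and R_descend: "\<lbrakk>\<alpha> \<in> R; F \<alpha> \<alpha> \<noteq> 0; \<beta> \<in> R\<rbrakk> \<Longrightarrow>
      \<exists>m::int. 2 * F \<beta> \<alpha> = of_int m * F \<alpha> \<alpha>
        \<and> (\<forall>i. 0 \<le> i \<and> i \<le> m \<longrightarrow> \<beta> - scale (of_int i) \<alpha> \<in> R)"
    and R_isotropic_orthogonal: "\<lbrakk>\<delta> \<in> R; F \<delta> \<delta> = 0; \<beta> \<in> R\<rbrakk> \<Longrightarrow> F \<delta> \<beta> = 0"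
    and R_irreducible: "\<not> (\<exists>A C. A \<noteq> {} \<and> C \<noteq> {} \<and> A \<inter> C = {}
        \<and> A \<union> C = {\<alpha> \<in> R. F \<alpha> \<alpha> \<noteq> 0} \<and> (\<forall>a\<in>A. \<forall>c\<in>C. F a c = 0))"
    and R_isotropic_nonisolated:
      "\<lbrakk>\<delta> \<in> R; F \<delta> \<delta> = 0\<rbrakk> \<Longrightarrow> \<exists>\<alpha>\<in>R. F \<alpha> \<alpha> \<noteq> 0 \<and> \<alpha> + \<delta> \<in> R"
    and R_normalized: "\<exists>\<alpha>\<in>R. F \<alpha> \<alpha> = 1"
    and R_finite_span: "\<exists>S. finite S \<and> R \<subseteq> span S"
begin

lemma F_add_right: "F z (x + y) = F z x + F z y"
  by (metis F_add_left F_sym)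

lemma F_scale_right: "F z (scale c x) = c * F z x"
  by (metis F_scale_left F_sym)

lemma F_minus_left: "F (- x) z = - F x z"
  using F_scale_left[of "-1" x z] by simp

lemma F_minus_right: "F z (- x) = - F z x"
  by (metis F_minus_left F_sym)

lemma F_diff_left: "F (x - y) z = F x z - F y z"
  using F_add_left[of x "- y" z] by (simp add: F_minus_left)

lemma F_diff_right: "F z (x - y) = F z x - F z y"
  by (metis F_diff_left F_sym)

lemmas F_simps = F_add_left F_add_right F_scale_left F_scale_right F_minus_left F_minus_right
  F_diff_left F_diff_right

lemma cartan_exists:
  assumes "\<alpha> \<in> R" "F \<alpha> \<alpha> \<noteq> 0" "\<beta> \<in> R"
  obtains m :: int where "2 * F \<beta> \<alpha> = of_int m * F \<alpha> \<alpha>"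
  using R_descend[OF assms] by blast

lemma descend:
  assumes "\<alpha> \<in> R" "F \<alpha> \<alpha> \<noteq> 0" "\<beta> \<in> R" "2 * F \<beta> \<alpha> = of_int m * F \<alpha> \<alpha>" "0 \<le> i" "i \<le> m"
  shows "\<beta> - scale (of_int i) \<alpha> \<in> R"
proof -
  obtain m' where m': "2 * F \<beta> \<alpha> = of_int m' * F \<alpha> \<alpha>"
      "\<forall>i. 0 \<le> i \<and> i \<le> m' \<longrightarrow> \<beta> - scale (of_int i) \<alpha> \<in> R"
    using R_descend[OF assms(1-3)] by blast
  have "m' = m" using m'(1) assms(2,4) by simp
  thus ?thesis using m' assms by auto
qed

lemma ascend:
  assumes "\<alpha> \<in> R" "F \<alpha> \<alpha> \<noteq> 0" "\<beta> \<in> R" "2 * F \<beta> \<alpha> = of_int m * F \<alpha> \<alpha>" "0 \<le> i" "i \<le> - m"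
  shows "\<beta> + scale (of_int i) \<alpha> \<in> R"
  using descend[of "- \<alpha>" \<beta> "- m" i] assms R_neg by (simp add: F_simps)

lemma reflection:
  assumes "\<alpha> \<in> R" "F \<alpha> \<alpha> \<noteq> 0" "\<beta> \<in> R" "2 * F \<beta> \<alpha> = of_int m * F \<alpha> \<alpha>"
  shows "\<beta> - scale (of_int m) \<alpha> \<in> R"
  using descend[OF assms, of m] ascend[OF assms, of "- m"] by (cases "m \<ge> 0") auto

text \<open>If the Gram matrix of \<open>\<alpha>\<close>, \<open>\<beta>\<close> were indefinite, the product of the two reflections would have
  infinite order; the fourth root of the orbit already spans with \<open>\<alpha>\<close> a lattice of so large
  discriminant that the middle of its \<open>\<alpha>\<close>-string violates integrality.\<close>

lemma cartan_product:
  assumes a: "\<alpha> \<in> R" "F \<alpha> \<alpha> \<noteq> 0" and b: "\<beta> \<in> R" "F \<beta> \<beta> \<noteq> 0"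
    and m: "2 * F \<beta> \<alpha> = of_int m * F \<alpha> \<alpha>" and m': "2 * F \<beta> \<alpha> = of_int m' * F \<beta> \<beta>"
  shows "0 \<le> m * m'" "m * m' \<le> 4"
proof -
  define t where "t = m * m'"
  define y where "y = t^2 - 3 * t + 1"
  have False if t: "t \<le> -1 \<or> t \<ge> 5"
  proof -
    have ab: "2 * F \<alpha> \<beta> = of_int m' * F \<beta> \<beta>" using m' F_sym by simp
    have comb: "scale (of_int i) \<beta> - scale (of_int j) \<alpha> - scale (of_int k) \<beta>
        = scale (of_int (i - k)) \<beta> - scale (of_int j) \<alpha>"
      "scale (of_int i) \<beta> - scale (of_int j) \<alpha> - scale (of_int k) \<alpha>
        = scale (of_int i) \<beta> - scale (of_int (j + k)) \<alpha>" for i j k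
      by (simp_all add: scale_left_diff_distrib scale_left_distrib)
    \<comment> \<open>Reflections in \<alpha> and \<beta> alternate. On the plane of \<alpha>,
      \<beta> their product has determinant 1 and trace \<open>t - 2\<close>, so for
      \<open>t\<close> outside 0..4 the coefficients 1, \<open>t - 1\<close>,
      \<open>t^2 - 3 t + 1\<close> of \<beta> grow.\<close>
    have b1: "scale (of_int 1) \<beta> - scale (of_int m) \<alpha> \<in> R" (is "?b1 \<in> R")
      using reflection[OF a b(1) m] by simp
    have "2 * F ?b1 \<beta> = of_int (2 - t) * F \<beta> \<beta>"
      using ab by (simp add: F_simps t_def algebra_simps)
    note reflection[OF b b1 this, unfolded comb]
    also have "1 - (2 - t) = t - 1" by simp
    finally have b2: "scale (of_int (t - 1)) \<beta> - scale (of_int m) \<alpha> \<in> R" (is "?b2 \<in> R") .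
    have "2 * F ?b2 \<alpha> = of_int (m * (t - 3)) * F \<alpha> \<alpha>"
      using m by (simp add: F_simps algebra_simps)
    note reflection[OF a b2 this, unfolded comb]
    also have "m + m * (t - 3) = m * (t - 2)" by (simp add: algebra_simps)
    finally have b3: "scale (of_int (t - 1)) \<beta> - scale (of_int (m * (t - 2))) \<alpha> \<in> R"
      (is "?b3 \<in> R") .
    have "2 * F ?b3 \<beta> = of_int (2 * (t - 1) - (t - 2) * t) * F \<beta> \<beta>"
      using ab by (simp add: F_simps t_def algebra_simps)
    note reflection[OF b b3 this, unfolded comb]
    also have "t - 1 - (2 * (t - 1) - (t - 2) * t) = y"
      by (simp add: algebra_simps y_def power2_eq_square)
    finally have b4: "scale (of_int y) \<beta> - scale (of_int (m * (t - 2))) \<alpha> \<in> R" (is "?b4 \<in> R") .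
    have p4: "2 * F ?b4 \<alpha> = of_int (m * (t^2 - 5 * t + 5)) * F \<alpha> \<alpha>"
      using m by (simp add: F_simps algebra_simps y_def power2_eq_square)
    have "t^2 - 5 * t + 5 \<noteq> 0"
    proof -
      from t have "t * (t - 5) \<ge> 0" by (auto intro: mult_nonneg_nonneg mult_nonpos_nonpos)
      thus ?thesis by (simp add: algebra_simps power2_eq_square)
    qed
    moreover have "m \<noteq> 0" using t t_def by auto
    ultimately have p0: "m * (t^2 - 5 * t + 5) \<noteq> 0" by simp
    \<comment> \<open>The sign \<sigma> replaces the fourth root by its negative if necessary, so
      that its Cartan number \<open>p\<close> is positive and its string can be descended.\<close>
    obtain \<sigma> p where \<sigma>: "\<sigma> = 1 \<or> \<sigma> = (-1::int)" and p: "p = \<sigma> * (m * (t^2 - 5 * t + 5))" "p > 0"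
      using p0 by (metis linorder_neqE_linordered_idom mult_1 mult_minus1 neg_0_less_iff_less)
    define g where "g = scale (of_int (\<sigma> * y)) \<beta> - scale (of_int (\<sigma> * (m * (t - 2)))) \<alpha>"
    have gR: "g \<in> R" using b4 R_neg[OF b4] \<sigma> by (auto simp: g_def)
    have "2 * F g \<alpha> = of_int \<sigma> * (2 * F ?b4 \<alpha>)" by (simp add: g_def F_simps algebra_simps)
    hence gp: "2 * F g \<alpha> = of_int p * F \<alpha> \<alpha>" unfolding p4 p(1) by simp
    \<comment> \<open>\<open>n\<close> steps down lead to the last positive Cartan number
      \<open>e\<close>: 1 for odd \<open>p\<close>, 2 for even \<open>p\<close>. Stopping before 0
      keeps \<open>g'\<close> non-orthogonal to \<alpha>, hence nonisotropic, so that \<alpha> has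
      an integral Cartan number \<open>k\<close> against \<open>g'\<close>.\<close>
    define n where "n = (p - 1) div 2"
    define e where "e = p - 2 * n"
    have e: "e = 1 \<or> e = 2" and n: "0 \<le> n" "n \<le> p" using p(2) by (auto simp: e_def n_def)
    define z where "z = - (\<sigma> * (m * (t - 2))) - n"
    define g' where "g' = scale (of_int (\<sigma> * y)) \<beta> + scale (of_int z) \<alpha>"
    have g'_eq: "g' = g - scale (of_int n) \<alpha>"
      by (simp add: g'_def g_def z_def scale_left_diff_distrib)
    hence g'R: "g' \<in> R" using descend[OF a gR gp n] g'_eq by simp
    have g'e: "2 * F g' \<alpha> = of_int e * F \<alpha> \<alpha>"
      unfolding g'_eq using gp by (simp add: F_simps e_def algebra_simps)
    hence "F g' \<alpha> \<noteq> 0" using e a(2) by auto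
    hence g'0: "F g' g' \<noteq> 0" using R_isotropic_orthogonal[OF g'R _ a(1)] by blast
    obtain k where k: "2 * F \<alpha> g' = of_int k * F g' g'" using cartan_exists[OF g'R g'0 a(1)] .
    have ze: "of_int e = of_int (\<sigma> * y) * of_int m + 2 * (of_int z :: 'k)"
    proof -
      have "of_int e * F \<alpha> \<alpha> = (of_int (\<sigma> * y) * of_int m + 2 * of_int z) * F \<alpha> \<alpha>"
        using g'e m by (simp add: g'_def F_simps algebra_simps)
      thus ?thesis using a(2) by simp
    qed
    have \<sigma>2: "(of_int \<sigma> :: 'k)^2 = 1" using \<sigma> by auto
    \<comment> \<open>Completing the square: \<open>ze\<close> says
      \<open>2 z = e - \<sigma> y m\<close>, which eliminates \<open>z\<close> from the norm of
      \<open>g'\<close> and leaves only \<open>y\<close>, \<open>m\<close> and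
      \<open>e\<close>.\<close>
    have "F g' g' = of_int (\<sigma> * y)^2 * F \<beta> \<beta> + of_int (\<sigma> * y) * of_int z * (2 * F \<beta> \<alpha>) + of_int z ^ 2 * F \<alpha> \<alpha>"
      using F_sym[of \<alpha> \<beta>] by (simp add: g'_def F_simps algebra_simps power2_eq_square)
    also have "of_int (\<sigma> * y)^2 = (of_int y :: 'k)^2" using \<sigma>2 by (simp add: power_mult_distrib)
    finally have "4 * F g' g' = 4 * of_int y ^ 2 * F \<beta> \<beta>
        + F \<alpha> \<alpha> * (4 * (of_int (\<sigma> * y) * of_int m) * of_int z + 4 * of_int z ^ 2)"
      unfolding m by (simp add: algebra_simps)
    also have "4 * (of_int (\<sigma> * y) * of_int m) * of_int z + 4 * of_int z ^ 2
        = of_int e ^ 2 - (of_int (\<sigma> * y) * of_int m :: 'k)^2"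
      unfolding ze by (simp add: power2_eq_square algebra_simps)
    also have "(of_int (\<sigma> * y) * of_int m :: 'k)^2 = of_int y ^ 2 * of_int m ^ 2"
      using \<sigma>2 by (simp add: power_mult_distrib)
    finally have n4: "4 * F g' g' = 4 * of_int y ^ 2 * F \<beta> \<beta>
        + F \<alpha> \<alpha> * (of_int e ^ 2 - of_int y ^ 2 * of_int m ^ 2)" .
    have bm: "of_int m' * F \<beta> \<beta> = of_int m * F \<alpha> \<alpha>" using m m' by simp
    have "of_int (4 * m' * e) * F \<alpha> \<alpha> = 4 * of_int m' * (2 * F g' \<alpha>)"
      using g'e by simp
    also have "\<dots> = of_int k * (of_int m' * (4 * F g' g'))"
      using k F_sym[of g' \<alpha>] by simp
    also have "of_int m' * (4 * F g' g') = 4 * of_int y ^ 2 * (of_int m' * F \<beta> \<beta>)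
        + of_int m' * F \<alpha> \<alpha> * (of_int e ^ 2 - of_int y ^ 2 * of_int m ^ 2)"
      unfolding n4 by (simp add: algebra_simps)
    also have "\<dots> = of_int (4 * y^2 * m + m' * e^2 - y^2 * m^2 * m') * F \<alpha> \<alpha>"
      unfolding bm by (simp add: algebra_simps)
    finally have "(of_int (4 * m' * e) :: 'k) = of_int (k * (4 * y^2 * m + m' * e^2 - y^2 * m^2 * m'))"
      using a(2) by (simp add: mult.assoc)
    hence "4 * m' * e = k * (4 * y^2 * m + m' * e^2 - y^2 * m^2 * m')" by (simp only: of_int_eq_iff)
    from cartan_product_bound[OF t_def t y_def e this] show False .
  qed
  thus "0 \<le> m * m'" "m * m' \<le> 4" unfolding t_def by force+
qed

text \<open>If \<open>m\<close> is nonzero then \<beta> is nonisotropic, so the opposite Cartan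
  number \<open>m'\<close> exists and is a nonzero integer; hence \<open>\<bar>m\<bar>\<close> is at
  most \<open>\<bar>m * m'\<bar>\<close>.\<close>

lemma cartan_bound:
  assumes a: "\<alpha> \<in> R" "F \<alpha> \<alpha> \<noteq> 0" and b: "\<beta> \<in> R"
    and m: "2 * F \<beta> \<alpha> = of_int m * F \<alpha> \<alpha>"
  shows "\<bar>m\<bar> \<le> 4"
proof (cases "m = 0")
  case False
  hence nz: "F \<beta> \<alpha> \<noteq> 0" using m a(2) by auto
  hence b0: "F \<beta> \<beta> \<noteq> 0" using R_isotropic_orthogonal[OF b _ a(1)] by blast
  obtain m' where m': "2 * F \<alpha> \<beta> = of_int m' * F \<beta> \<beta>" using cartan_exists[OF b b0 a(1)] .
  hence m'': "2 * F \<beta> \<alpha> = of_int m' * F \<beta> \<beta>" using F_sym by simp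
  have "m' \<noteq> 0" using m'' nz by auto
  hence "\<bar>m\<bar> \<le> \<bar>m\<bar> * \<bar>m'\<bar>" using mult_left_mono[of 1 "\<bar>m'\<bar>" "\<bar>m\<bar>"] by simp
  also have "\<dots> \<le> 4" using cartan_product[OF a b b0 m m''] by (simp flip: abs_mult)
  finally show ?thesis .
qed simp

text \<open>Along the string the Cartan number grows by 2 per step and stays between -4 and 4, so
  the string is finite. Its lowest member is the reflection of its highest, and descending from the
  highest fills everything in between.\<close>

lemma string:
  assumes a: "\<alpha> \<in> R" "F \<alpha> \<alpha> \<noteq> 0" and b: "\<beta> \<in> R"
  obtains d u :: nat where "\<And>n::int. \<beta> + scale (of_int n) \<alpha> \<in> R \<longleftrightarrow> - int d \<le> n \<and> n \<le> int u"
    and "2 * F \<beta> \<alpha> = (of_nat d - of_nat u) * F \<alpha> \<alpha>"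
proof -
  obtain m where m: "2 * F \<beta> \<alpha> = of_int m * F \<alpha> \<alpha>" using cartan_exists[OF a b] .
  define N where "N = {n::int. \<beta> + scale (of_int n) \<alpha> \<in> R}"
  have mn: "2 * F (\<beta> + scale (of_int n) \<alpha>) \<alpha> = of_int (m + 2 * n) * F \<alpha> \<alpha>" for n
    using m by (simp add: F_simps algebra_simps)
  have down: "n - i \<in> N" if "n \<in> N" "0 \<le> i" "i \<le> m + 2 * n" for n i
    using descend[OF a _ mn that(2,3)] that(1) by (simp add: N_def algebra_simps)
  have up: "n + i \<in> N" if "n \<in> N" "0 \<le> i" "i \<le> - (m + 2 * n)" for n i
    using ascend[OF a _ mn that(2,3)] that(1) by (simp add: N_def algebra_simps)
  have "N \<subseteq> {- m - 4 .. 4 - m} \<union> {-\<bar>m\<bar> - 4 .. \<bar>m\<bar> + 4}"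
    using cartan_bound[OF a _ mn] by (force simp: N_def)
  hence fin: "finite N" by (rule finite_subset) auto
  have N0: "0 \<in> N" using b by (simp add: N_def)
  have refl: "- m - n \<in> N" if "n \<in> N" for n
    using down[OF that, of "m + 2 * n"] up[OF that, of "- (m + 2 * n)"]
    by (cases "m + 2 * n \<ge> 0") (auto simp: algebra_simps)
  define u where "u = Max N"
  have uN: "u \<in> N" and umax: "n \<in> N \<Longrightarrow> n \<le> u" for n
    using Max_in[OF fin] Max_ge[OF fin] N0 by (auto simp: u_def)
  have "0 \<le> u" using umax N0 by auto
  have dmin: "- m - u \<le> n" if "n \<in> N" for n using umax[OF refl[OF that]] by simp
  have d0: "m + u \<ge> 0" using dmin[OF N0] by simp
  have iff: "n \<in> N \<longleftrightarrow> - m - u \<le> n \<and> n \<le> u" for n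
    using umax dmin down[OF uN, of "u - n"] by auto
  show ?thesis
  proof (rule that[of "nat (m + u)" "nat u"])
    show "\<beta> + scale (of_int n) \<alpha> \<in> R \<longleftrightarrow> - int (nat (m + u)) \<le> n \<and> n \<le> int (nat u)" for n
      using iff[of n] d0 \<open>0 \<le> u\<close> by (simp add: N_def algebra_simps)
    have "(of_nat (nat (m + u)) :: 'k) = of_int (m + u)" "(of_nat (nat u) :: 'k) = of_int u"
      using d0 \<open>0 \<le> u\<close> by (metis of_int_of_nat_eq nat_0_le)+
    thus "2 * F \<beta> \<alpha> = (of_nat (nat (m + u)) - of_nat (nat u)) * F \<alpha> \<alpha>"
      using m by simp
  qed
qed

text \<open>Irreducibility in the form of an induction: if \<open>P\<close> passes between
  non-orthogonal roots, the roots with \<open>P\<close> and those without it are orthogonal to each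
  other, so one of the two sets is empty.\<close>

lemma irreducible_induct:
  assumes "\<alpha>0 \<in> R" "F \<alpha>0 \<alpha>0 \<noteq> 0" "P \<alpha>0"
    and step: "\<And>\<alpha> \<beta>. \<lbrakk>\<alpha> \<in> R; F \<alpha> \<alpha> \<noteq> 0; \<beta> \<in> R; F \<beta> \<beta> \<noteq> 0; F \<alpha> \<beta> \<noteq> 0; P \<alpha>\<rbrakk> \<Longrightarrow> P \<beta>"
    and "\<alpha> \<in> R" "F \<alpha> \<alpha> \<noteq> 0"
  shows "P \<alpha>"
proof (rule ccontr)
  assume "\<not> P \<alpha>"
  define A where "A = {\<alpha> \<in> R. F \<alpha> \<alpha> \<noteq> 0 \<and> P \<alpha>}"
  define C where "C = {\<alpha> \<in> R. F \<alpha> \<alpha> \<noteq> 0 \<and> \<not> P \<alpha>}"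
  have "A \<noteq> {}" "C \<noteq> {}" "A \<inter> C = {}" "A \<union> C = {\<alpha> \<in> R. F \<alpha> \<alpha> \<noteq> 0}"
    using assms \<open>\<not> P \<alpha>\<close> by (auto simp: A_def C_def)
  moreover have "\<forall>a\<in>A. \<forall>c\<in>C. F a c = 0" using step by (auto simp: A_def C_def)
  ultimately show False using R_irreducible by blast
qed

text \<open>Two non-orthogonal roots have norms in the ratio \<open>m / m'\<close> of their Cartan
  numbers, which is positive because \<open>m * m'\<close> is nonnegative and nonzero. The norm 1 of
  the normalized root thus propagates.\<close>

lemma norm_pos_rat:
  assumes "\<alpha> \<in> R" "F \<alpha> \<alpha> \<noteq> 0"
  shows "\<exists>q>0. F \<alpha> \<alpha> = of_rat q"
proof -
  obtain \<alpha>0 where \<alpha>0: "\<alpha>0 \<in> R" "F \<alpha>0 \<alpha>0 = 1" using R_normalized by blast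
  show ?thesis
  proof (rule irreducible_induct[of \<alpha>0 "\<lambda>\<alpha>. \<exists>q>0. F \<alpha> \<alpha> = of_rat q"])
    show "\<exists>q>0. F \<alpha>0 \<alpha>0 = of_rat q" using \<alpha>0 by (intro exI[of _ 1]) simp
  next
    fix \<alpha> \<beta> assume h: "\<alpha> \<in> R" "F \<alpha> \<alpha> \<noteq> 0" "\<beta> \<in> R" "F \<beta> \<beta> \<noteq> 0" "F \<alpha> \<beta> \<noteq> 0" "\<exists>q>0. F \<alpha> \<alpha> = of_rat q"
    then obtain q where q: "q > 0" "F \<alpha> \<alpha> = of_rat q" by blast
    obtain m where m: "2 * F \<beta> \<alpha> = of_int m * F \<alpha> \<alpha>" using cartan_exists[OF h(1-3)] .
    obtain m' where "2 * F \<alpha> \<beta> = of_int m' * F \<beta> \<beta>" using cartan_exists[OF h(3,4,1)] .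
    hence m': "2 * F \<beta> \<alpha> = of_int m' * F \<beta> \<beta>" using F_sym by simp
    have nz: "m \<noteq> 0" "m' \<noteq> 0" using m m' h(5) F_sym[of \<alpha> \<beta>] by auto
    have "m * m' > 0" using cartan_product(1)[OF h(1-4) m m'] nz by (simp add: order.strict_iff_order)
    hence pos: "(of_int m / of_int m' :: rat) > 0" by (auto simp: zero_less_mult_iff intro: divide_neg_neg)
    have "F \<beta> \<beta> = of_int m * F \<alpha> \<alpha> / of_int m'" using m m' nz by (simp add: field_simps)
    also have "\<dots> = of_rat (of_int m / of_int m' * q)"
      by (simp add: q(2) of_rat_mult of_rat_divide)
    finally show "\<exists>q>0. F \<beta> \<beta> = of_rat q" using mult_pos_pos[OF pos q(1)] by blast
  qed (use \<alpha>0 assms in auto)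
qed

lemma form_rat:
  assumes "\<alpha> \<in> R" "\<beta> \<in> R"
  shows "\<exists>q. F \<alpha> \<beta> = of_rat q"
proof (cases "F \<beta> \<beta> = 0")
  case True
  hence "F \<alpha> \<beta> = of_rat 0" using R_isotropic_orthogonal[of \<beta> \<alpha>] assms F_sym by simp
  thus ?thesis ..
next
  case False
  obtain q where q: "F \<beta> \<beta> = of_rat q" using norm_pos_rat[OF assms(2) False] by blast
  obtain m where "2 * F \<alpha> \<beta> = of_int m * F \<beta> \<beta>" using cartan_exists[OF assms(2) False assms(1)] .
  hence "F \<alpha> \<beta> = of_rat (of_int m * q / 2)" by (simp add: q of_rat_mult of_rat_divide field_simps)
  thus ?thesis ..
qed

text \<open>A root is labelled by its Cartan numbers against a maximal independent set of
  nonisotropic roots; finitely many labels occur, and \<open>P\<close> picks one root for each.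
  Equal labels make the difference orthogonal to all nonisotropic roots, in particular to both roots
  themselves. It is therefore isotropic, their Cartan number is 2, and one step down the string
  shows that the difference is a root.\<close>

lemma finite_mod_isotropic:
  obtains P where "finite P" "P \<subseteq> {\<alpha> \<in> R. F \<alpha> \<alpha> \<noteq> 0}"
    and "\<And>\<gamma>. \<gamma> \<in> R \<Longrightarrow> F \<gamma> \<gamma> \<noteq> 0 \<Longrightarrow> \<exists>\<gamma>'\<in>P. \<gamma> - \<gamma>' \<in> R \<and> F (\<gamma> - \<gamma>') (\<gamma> - \<gamma>') = 0"
proof -
  let ?X = "{\<alpha> \<in> R. F \<alpha> \<alpha> \<noteq> 0}"
  obtain b where b: "b \<subseteq> ?X" "independent b" "?X \<subseteq> span b"
    using maximal_independent_subset[of ?X] by blast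
  obtain S where S: "finite S" "R \<subseteq> span S" using R_finite_span by blast
  have finb: "finite b" using independent_span_bound[OF S(1) b(2)] b(1) S(2) by blast
  define n where "n \<gamma> \<alpha> = (SOME m::int. 2 * F \<gamma> \<alpha> = of_int m * F \<alpha> \<alpha>)" for \<gamma> \<alpha>
  have n: "2 * F \<gamma> \<alpha> = of_int (n \<gamma> \<alpha>) * F \<alpha> \<alpha>" if "\<alpha> \<in> ?X" "\<gamma> \<in> R" for \<gamma> \<alpha>
    unfolding n_def by (rule someI_ex) (use R_descend that in blast)
  define g where "g \<gamma> = restrict (n \<gamma>) b" for \<gamma>
  have "g ` ?X \<subseteq> PiE b (\<lambda>_. {-4..4})"
  proof
    fix f assume "f \<in> g ` ?X"
    then obtain \<gamma> where \<gamma>: "\<gamma> \<in> R" "f = g \<gamma>" by blast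
    have "\<bar>n \<gamma> \<alpha>\<bar> \<le> 4" if "\<alpha> \<in> b" for \<alpha>
      using cartan_bound[of \<alpha> \<gamma>] n[of \<alpha> \<gamma>] that b(1) \<gamma>(1) by blast
    thus "f \<in> PiE b (\<lambda>_. {-4..4})" unfolding \<gamma>(2) g_def by (force simp: PiE_def abs_le_iff)
  qed
  hence "finite (g ` ?X)" by (rule finite_subset) (simp add: finb finite_PiE)
  then obtain P where P: "P \<subseteq> ?X" "finite P" "g ` ?X = g ` P"
    using finite_subset_image[of "g ` ?X" g ?X] by auto
  show ?thesis
  proof (rule that[OF P(2,1)])
    fix \<gamma> assume \<gamma>: "\<gamma> \<in> R" "F \<gamma> \<gamma> \<noteq> 0"
    then obtain \<gamma>' where \<gamma>': "\<gamma>' \<in> P" "g \<gamma> = g \<gamma>'" using P(3) by (force simp: image_iff)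
    hence \<gamma>'R: "\<gamma>' \<in> R" "F \<gamma>' \<gamma>' \<noteq> 0" using P(1) by auto
    have 0: "F \<alpha> (\<gamma> - \<gamma>') = 0" if "\<alpha> \<in> b" for \<alpha>
    proof -
      have "n \<gamma> \<alpha> = n \<gamma>' \<alpha>" using \<gamma>'(2) that by (auto simp: g_def dest: fun_cong[of _ _ \<alpha>])
      moreover have "\<alpha> \<in> ?X" using that b(1) by blast
      ultimately have "2 * F \<gamma> \<alpha> = 2 * F \<gamma>' \<alpha>" using n[of \<alpha> \<gamma>] n[of \<alpha> \<gamma>'] \<gamma>(1) \<gamma>'R(1) by simp
      thus ?thesis by (simp add: F_simps F_sym[of \<alpha>])
    qed
    have "subspace {v. F v (\<gamma> - \<gamma>') = 0}"
      using F_scale_left[of 0 0] by (intro subspaceI) (auto simp: F_add_left F_scale_left)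
    hence "span b \<subseteq> {v. F v (\<gamma> - \<gamma>') = 0}" using 0 by (intro span_minimal) auto
    hence 0: "F v (\<gamma> - \<gamma>') = 0" if "v \<in> ?X" for v using b(3) that by blast
    have "F \<gamma> \<gamma>' = F \<gamma> \<gamma>" "F \<gamma>' \<gamma> = F \<gamma>' \<gamma>'" using 0[of \<gamma>] 0[of \<gamma>'] \<gamma> \<gamma>'R by (auto simp: F_simps)
    hence e: "F (\<gamma> - \<gamma>') (\<gamma> - \<gamma>') = 0" "2 * F \<gamma> \<gamma>' = of_int 2 * F \<gamma>' \<gamma>'"
      using F_sym[of \<gamma> \<gamma>'] by (auto simp: F_simps)
    have "\<gamma> - scale (of_int 1) \<gamma>' \<in> R" by (rule descend[OF \<gamma>'R \<gamma>(1) e(2)]) auto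
    thus "\<exists>\<gamma>'\<in>P. \<gamma> - \<gamma>' \<in> R \<and> F (\<gamma> - \<gamma>') (\<gamma> - \<gamma>') = 0" using e \<gamma>'(1) by auto
  qed
qed

end

section \<open>Positivity and discreteness over the reals\<close>

text \<open>Why invariance makes \<open>Q\<close> proportional to \<open>F\<close>: if
  \<open>v\<close> is \<open>F\<close>-orthogonal to a nonisotropic root \<alpha>, the reflection
  fixes \<open>v\<close> and negates \<alpha>, so \<open>Q v \<alpha> = - Q v \<alpha>\<close> and
  \<open>v\<close> is also \<open>Q\<close>-orthogonal to \<alpha>. Hence \<open>Q\<close> and
  \<open>F\<close> paired with \<alpha> differ by a factor depending only on \<alpha>, and symmetry
  forces equal factors at non-orthogonal roots.\<close>

lemma root_datum_positive_semidefinite: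
  fixes F :: "'v::real_vector \<Rightarrow> 'v \<Rightarrow> real"
  assumes rd: "root_datum (*\<^sub>R) F R" and spn: "span R = UNIV"
  shows "0 \<le> F v v"
proof -
  interpret rd: root_datum "(*\<^sub>R)" F R by (rule rd)
  define X where "X = {\<alpha> \<in> R. F \<alpha> \<alpha> \<noteq> 0}"
  define co where "co \<gamma> v = 2 * F v \<gamma> / F \<gamma> \<gamma>" for \<gamma> v
  define s where "s \<alpha> v = v - co \<alpha> v *\<^sub>R \<alpha>" for \<alpha> v
  \<comment> \<open>A set of functionals and not of roots: \<open>X\<close> may be infinite, but
    roots that differ by an isotropic root give the same functional, so the sum defining
    \<open>Q\<close> is finite.\<close>
  define \<Phi> where "\<Phi> = co ` X"
  define Q where "Q v w = (\<Sum>f\<in>\<Phi>. f v * f w)" for v w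

  have radical: "F v \<delta> = 0" if "\<delta> \<in> R" "F \<delta> \<delta> = 0" for \<delta> v
  proof -
    have "v \<in> span R" using spn by simp
    hence "F \<delta> v = 0"
    proof (induction rule: span_induct_alt)
      case base show ?case using rd.F_scale_right[of \<delta> 0 0] by simp
    next
      case (step c x y) thus ?case
        using rd.R_isotropic_orthogonal[OF that] by (simp add: rd.F_simps)
    qed
    thus ?thesis using rd.F_sym by simp
  qed
  obtain P where P: "finite P"
    "\<And>\<gamma>. \<gamma> \<in> R \<Longrightarrow> F \<gamma> \<gamma> \<noteq> 0 \<Longrightarrow> \<exists>\<gamma>'\<in>P. \<gamma> - \<gamma>' \<in> R \<and> F (\<gamma> - \<gamma>') (\<gamma> - \<gamma>') = 0"
    using rd.finite_mod_isotropic by metis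
  have "\<Phi> \<subseteq> co ` P"
  proof
    fix f assume "f \<in> \<Phi>"
    then obtain \<gamma> where \<gamma>: "\<gamma> \<in> X" "f = co \<gamma>" by (auto simp: \<Phi>_def)
    then obtain \<gamma>' where \<gamma>': "\<gamma>' \<in> P" "\<gamma> - \<gamma>' \<in> R" "F (\<gamma> - \<gamma>') (\<gamma> - \<gamma>') = 0"
      using P(2) by (auto simp: X_def)
    have "F v \<gamma> = F v \<gamma>'" for v using radical[OF \<gamma>'(2,3), of v] by (simp add: rd.F_simps)
    hence "co \<gamma> = co \<gamma>'" unfolding co_def by (metis rd.F_sym)
    thus "f \<in> co ` P" using \<gamma>(2) \<gamma>'(1) by simp
  qed
  hence fin: "finite \<Phi>" using P(1) finite_surj by blast

  have s_form: "F (s \<alpha> v) \<gamma> = F v (s \<alpha> \<gamma>)" for \<alpha> v \<gamma>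
    by (simp add: s_def co_def rd.F_simps rd.F_sym[of \<alpha> \<gamma>])
  have s_s: "s \<alpha> (s \<alpha> v) = v" and s_neg: "s \<alpha> \<alpha> = - \<alpha>" if "\<alpha> \<in> X" for \<alpha> v
  proof -
    have "co \<alpha> (s \<alpha> v) = - co \<alpha> v" using that by (simp add: s_def co_def rd.F_simps X_def field_simps)
    thus "s \<alpha> (s \<alpha> v) = v" by (simp add: s_def[of \<alpha> "s \<alpha> v"]) (simp add: s_def)
    show "s \<alpha> \<alpha> = - \<alpha>" using that by (simp add: s_def co_def X_def scaleR_2)
  qed
  have s_X: "s \<alpha> \<gamma> \<in> X" if "\<alpha> \<in> X" "\<gamma> \<in> X" for \<alpha> \<gamma>
  proof -
    obtain m where m: "2 * F \<gamma> \<alpha> = of_int m * F \<alpha> \<alpha>"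
      using rd.cartan_exists[of \<alpha> \<gamma>] \<open>\<alpha> \<in> X\<close> \<open>\<gamma> \<in> X\<close> unfolding X_def by blast
    have "\<gamma> - of_int m *\<^sub>R \<alpha> \<in> R" using rd.reflection[OF _ _ _ m] that by (simp add: X_def)
    moreover have "co \<alpha> \<gamma> = of_int m" using m that by (simp add: co_def X_def)
    moreover have "F (s \<alpha> \<gamma>) (s \<alpha> \<gamma>) = F \<gamma> \<gamma>" using s_form s_s that by simp
    ultimately show ?thesis using that by (simp add: X_def s_def)
  qed
  have co_s: "co \<gamma> \<circ> s \<alpha> = co (s \<alpha> \<gamma>)" if "\<alpha> \<in> X" for \<alpha> \<gamma>
    using s_form[of \<alpha>] s_s[OF that] by (simp add: co_def fun_eq_iff)
  have Q_s: "Q (s \<alpha> v) (s \<alpha> w) = Q v w" if "\<alpha> \<in> X" for \<alpha> v w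
    unfolding Q_def
  proof (rule sum.reindex_bij_witness[where i = "\<lambda>f. f \<circ> s \<alpha>" and j = "\<lambda>f. f \<circ> s \<alpha>"])
    show "f \<circ> s \<alpha> \<circ> s \<alpha> = f" for f :: "'v \<Rightarrow> real" using s_s[OF that] by auto
    thus "f \<circ> s \<alpha> \<circ> s \<alpha> = f" for f :: "'v \<Rightarrow> real" .
    show "f \<circ> s \<alpha> \<in> \<Phi>" if "f \<in> \<Phi>" for f using that co_s s_X \<open>\<alpha> \<in> X\<close> by (auto simp: \<Phi>_def)
    thus "f \<circ> s \<alpha> \<in> \<Phi>" if "f \<in> \<Phi>" for f using that .
  qed auto
  have Q_add: "Q u (v + w) = Q u v + Q u w" for u v w
    unfolding Q_def sum.distrib[symmetric]
    by (rule sum.cong) (auto simp: \<Phi>_def co_def rd.F_simps add_divide_distrib algebra_simps)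
  have Q_scale: "Q u (c *\<^sub>R v) = c * Q u v" for u v c
    unfolding Q_def sum_distrib_left
    by (rule sum.cong) (auto simp: \<Phi>_def co_def rd.F_simps)
  have Q_sym: "Q v w = Q w v" for v w by (simp add: Q_def mult.commute)
  have Q_orth: "Q v \<alpha> = 0" if "\<alpha> \<in> X" "F v \<alpha> = 0" for v \<alpha>
  proof -
    have "s \<alpha> v = v" using that by (simp add: s_def co_def)
    hence "Q v \<alpha> = Q v ((-1) *\<^sub>R \<alpha>)" using Q_s[OF that(1), of v \<alpha>] s_neg[OF that(1)] by simp
    thus ?thesis unfolding Q_scale by simp
  qed
  have Q_root: "Q v \<alpha> * F \<alpha> \<alpha> = F v \<alpha> * Q \<alpha> \<alpha>" if "\<alpha> \<in> X" for v \<alpha>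
  proof -
    define k where "k = F v \<alpha> / F \<alpha> \<alpha>"
    have "F \<alpha> \<alpha> \<noteq> 0" using that by (simp add: X_def)
    hence "Q (v + (- k) *\<^sub>R \<alpha>) \<alpha> = 0" by (intro Q_orth[OF that]) (simp add: rd.F_simps k_def)
    hence "Q \<alpha> (v + (- k) *\<^sub>R \<alpha>) = 0" using Q_sym by metis
    hence "Q v \<alpha> = k * Q \<alpha> \<alpha>" unfolding Q_add Q_scale using Q_sym[of v \<alpha>] by simp
    thus ?thesis using \<open>F \<alpha> \<alpha> \<noteq> 0\<close> by (simp add: k_def)
  qed

  obtain \<alpha>0 where \<alpha>0: "\<alpha>0 \<in> R" "F \<alpha>0 \<alpha>0 = 1" using rd.R_normalized by blast
  define c where "c = Q \<alpha>0 \<alpha>0"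
  have "co \<alpha>0 \<in> \<Phi>" using \<alpha>0 by (auto simp: \<Phi>_def X_def)
  hence "co \<alpha>0 \<alpha>0 * co \<alpha>0 \<alpha>0 \<le> c" unfolding c_def Q_def
    by (rule member_le_sum[where f = "\<lambda>f. f \<alpha>0 * f \<alpha>0"]) (use fin in auto)
  hence c: "c > 0" using \<alpha>0(2) by (simp add: co_def)
  have Q_norm: "Q \<alpha> \<alpha> = c * F \<alpha> \<alpha>" if "\<alpha> \<in> X" for \<alpha>
  proof (rule rd.irreducible_induct[of \<alpha>0 "\<lambda>\<alpha>. Q \<alpha> \<alpha> = c * F \<alpha> \<alpha>"])
    fix \<alpha> \<beta> assume h: "\<alpha> \<in> R" "F \<alpha> \<alpha> \<noteq> 0" "\<beta> \<in> R" "F \<beta> \<beta> \<noteq> 0" "F \<alpha> \<beta> \<noteq> 0"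
      "Q \<alpha> \<alpha> = c * F \<alpha> \<alpha>"
    hence X: "\<alpha> \<in> X" "\<beta> \<in> X" by (auto simp: X_def)
    have "Q \<beta> \<alpha> = c * F \<alpha> \<beta>" using Q_root[OF X(1), of \<beta>] h rd.F_sym[of \<beta> \<alpha>] by auto
    thus "Q \<beta> \<beta> = c * F \<beta> \<beta>" using Q_root[OF X(2), of \<alpha>] Q_sym[of \<alpha> \<beta>] h by simp
  qed (use \<alpha>0 that in \<open>auto simp: X_def c_def\<close>)
  have Q_X: "Q v \<alpha> = c * F v \<alpha>" if "\<alpha> \<in> X" for v \<alpha>
    using Q_root[OF that, of v] Q_norm[OF that] that by (auto simp: X_def)
  \<comment> \<open>An isotropic root is a difference of two nonisotropic ones, so testing
    \<open>Q\<close> against \<open>X\<close> determines it everywhere.\<close>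
  have "R \<subseteq> span X"
  proof
    fix \<delta> assume "\<delta> \<in> R"
    show "\<delta> \<in> span X"
    proof (cases "F \<delta> \<delta> = 0")
      case False
      thus ?thesis using \<open>\<delta> \<in> R\<close> by (intro span_base) (simp add: X_def)
    next
      case True
      then obtain \<alpha> where \<alpha>: "\<alpha> \<in> R" "F \<alpha> \<alpha> \<noteq> 0" "\<alpha> + \<delta> \<in> R"
        using rd.R_isotropic_nonisolated[OF \<open>\<delta> \<in> R\<close>] by blast
      have "F (\<alpha> + \<delta>) (\<alpha> + \<delta>) = F \<alpha> \<alpha>"
        using radical[OF \<open>\<delta> \<in> R\<close> True] by (simp add: rd.F_simps rd.F_sym[of \<delta> \<alpha>])
      hence "\<alpha> + \<delta> \<in> span X" "\<alpha> \<in> span X" using \<alpha> by (auto intro!: span_base simp: X_def)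
      thus ?thesis using span_diff by fastforce
    qed
  qed
  hence X_span: "span X = UNIV" using spn span_mono[of R "span X"] by (auto simp: span_span)
  have "Q v w = c * F v w" for w
  proof -
    have "w \<in> span X" using X_span by simp
    thus ?thesis
    proof (induction rule: span_induct_alt)
      case base show ?case using rd.F_scale_right[of v 0 0] Q_scale[of v 0 0] by simp
    next
      case (step k x y) thus ?case
        using Q_X by (simp add: Q_add Q_scale rd.F_simps algebra_simps)
    qed
  qed
  hence "c * F v v = Q v v" by simp
  also have "\<dots> \<ge> 0" unfolding Q_def by (intro sum_nonneg) auto
  finally show ?thesis using c by (simp add: zero_le_mult_iff)
qed

section \<open>Discreteness of finite unions of lattice cosets\<close>

text \<open>A nonzero integer combination has a coordinate of absolute value at least 1, and the
  coordinate functionals are bounded, which keeps its norm away from 0.\<close>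

lemma independent_int_combinations_separated:
  fixes S :: "'v::euclidean_space set"
  assumes "independent S"
  shows "\<exists>e>0. \<forall>c :: 'v \<Rightarrow> int.
    (\<Sum>b\<in>S. of_int (c b) *\<^sub>R b) \<noteq> 0 \<longrightarrow> e \<le> norm (\<Sum>b\<in>S. of_int (c b) *\<^sub>R b)"
proof -
  have fin: "finite S" using assms by (rule independent_imp_finite)
  have "\<exists>f K. linear f \<and> (\<forall>x\<in>S. f x = (if x = b then 1 else 0::real)) \<and> K > 0 \<and> (\<forall>x. \<bar>f x\<bar> \<le> K * norm x)" for b
  proof -
    obtain f where f: "linear f" "\<forall>x\<in>S. f x = (if x = b then 1 else 0::real)"
      using linear_independent_extend[OF assms, of "\<lambda>x. if x = b then 1 else 0"] by auto
    obtain K where "K > 0" "\<forall>x. norm (f x) \<le> K * norm x" using linear_bounded_pos[OF f(1)] by blast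
    thus ?thesis using f by auto
  qed
  then obtain f K where f: "\<And>b. linear (f b)" "\<And>b x. x \<in> S \<Longrightarrow> f b x = (if x = b then 1 else 0::real)"
    and K: "\<And>b. K b > 0" "\<And>b x. \<bar>f b x\<bar> \<le> K b * norm x" by metis
  \<comment> \<open>A common bound for all coordinate functionals; the summand 1 keeps it positive
    when \<open>S\<close> is empty.\<close>
  define M where "M = (\<Sum>b\<in>S. K b) + 1"
  have Mpos: "M > 0" unfolding M_def using K(1) by (intro add_nonneg_pos sum_nonneg) (auto intro: less_imp_le)
  show ?thesis
  proof (intro exI[of _ "1 / M"] conjI allI impI)
    show "1 / M > 0" using Mpos by simp
    fix c :: "'v \<Rightarrow> int" let ?v = "\<Sum>b\<in>S. of_int (c b) *\<^sub>R b"
    assume "?v \<noteq> 0"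
    then obtain b where b: "b \<in> S" "c b \<noteq> 0" by (metis (no_types, lifting) of_int_0 scaleR_zero_left sum.neutral)
    have "f b ?v = (\<Sum>x\<in>S. of_int (c x) * f b x)"
      by (simp add: linear_sum[OF f(1)] linear_scale[OF f(1)])
    also have "\<dots> = (\<Sum>x\<in>S. if x = b then of_int (c x) else 0)"
      by (rule sum.cong) (auto simp: f(2))
    also have "\<dots> = of_int (c b)" using b fin by simp
    finally have "\<bar>of_int (c b)\<bar> \<le> K b * norm ?v" using K(2)[of b ?v] by simp
    moreover have "(1::real) \<le> \<bar>of_int (c b)\<bar>" using b(2) by linarith
    moreover have "K b \<le> M" unfolding M_def
      using member_le_sum[of b S K] b fin K(1) by (force intro: less_imp_le)
    hence "K b * norm ?v \<le> M * norm ?v" by (intro mult_right_mono) auto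
    ultimately have "1 \<le> M * norm ?v" by linarith
    thus "1 / M \<le> norm ?v" using Mpos by (simp add: field_simps)
  qed
qed

text \<open>The ball of radius \<open>e / 2\<close> about \<open>x\<close> meets each translate of
  \<open>L\<close> in at most one point, so it contains only finitely many points of
  \<open>R\<close>.\<close>

lemma finite_union_of_cosets_discrete:
  fixes R :: "'v::real_normed_vector set"
  assumes "finite P" "e > 0" and cover: "\<And>x. x \<in> R \<Longrightarrow> \<exists>p\<in>P. x - p \<in> L"
    and sep: "\<And>x y. x \<in> L \<Longrightarrow> y \<in> L \<Longrightarrow> x \<noteq> y \<Longrightarrow> e \<le> dist x y"
  shows "\<exists>d>0. \<forall>y\<in>R. y \<noteq> x \<longrightarrow> d \<le> dist y x"
proof -
  define D where "D p = {y \<in> R. dist y x < e / 2 \<and> y - p \<in> L}" for p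
  have "finite (D p)" for p
  proof -
    have "y = z" if "y \<in> D p" "z \<in> D p" for y z
    proof (rule ccontr)
      assume "y \<noteq> z"
      hence "e \<le> dist (y - p) (z - p)" using that by (intro sep) (auto simp: D_def)
      also have "\<dots> = dist y z" by (simp add: dist_norm)
      also have "\<dots> \<le> dist y x + dist z x" by (rule dist_triangle2)
      also have "\<dots> < e" using that by (auto simp: D_def)
      finally show False by simp
    qed
    hence "D p = {} \<or> (\<exists>y. D p = {y})" by blast
    thus ?thesis by auto
  qed
  hence "finite (\<Union>p\<in>P. D p)" using assms(1) by blast
  then obtain d where d: "d > 0" "\<forall>y\<in>(\<Union>p\<in>P. D p). y \<noteq> x \<longrightarrow> d \<le> dist x y"
    using finite_set_avoid by metis
  show ?thesis
  proof (intro exI[of _ "min d (e / 2)"] conjI ballI impI)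
    show "min d (e / 2) > 0" using d(1) assms(2) by simp
    fix y assume "y \<in> R" "y \<noteq> x"
    thus "min d (e / 2) \<le> dist y x"
      using d(2) cover[of y] by (cases "dist y x < e / 2") (auto simp: D_def dist_commute[of x] min_le_iff_disj)
  qed
qed

section \<open>Linear functionals on a subspace\<close>

text \<open>Serves the existence of \<open>tvec\<close>: with the functionals \<open>B s\<close> for
  \<open>s\<close> in a finite spanning set of \<open>H\<close>, it turns nondegeneracy on
  \<open>H\<close> into a representing vector. Linearity is required only on the subspace because
  dual elements are extended by 0 outside \<open>H\<close>. The induction shrinks the subspace to
  the kernel of one functional.\<close>

lemma (in vector_space) functional_combination:
  assumes "finite S" "subspace H"
    and "\<And>s x y. s \<in> S \<Longrightarrow> x \<in> H \<Longrightarrow> y \<in> H \<Longrightarrow> f s (x + y) = f s x + f s y"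
    and "\<And>s c x. s \<in> S \<Longrightarrow> x \<in> H \<Longrightarrow> f s (scale c x) = c * f s x"
    and "\<And>x y. x \<in> H \<Longrightarrow> y \<in> H \<Longrightarrow> g (x + y) = g x + g y"
    and "\<And>c x. x \<in> H \<Longrightarrow> g (scale c x) = c * g x"
    and "\<And>h. h \<in> H \<Longrightarrow> (\<And>s. s \<in> S \<Longrightarrow> f s h = 0) \<Longrightarrow> g h = 0"
  shows "\<exists>c. \<forall>h\<in>H. g h = (\<Sum>s\<in>S. c s * f s h)"
  using assms
proof (induction S arbitrary: H rule: finite_induct)
  case empty
  thus ?case by auto
next
  case (insert s S)
  note H = \<open>subspace H\<close> and lin = insert.prems(2-5)
  define K where "K = {h \<in> H. f s h = 0}"
  have "f s 0 = 0" using lin(2)[of s 0 0] subspace_0[OF H] by simp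
  hence "subspace K" unfolding K_def using H lin
    by (intro subspaceI) (auto simp: subspace_0 subspace_add subspace_scale)
  have "\<exists>c. \<forall>h\<in>K. g h = (\<Sum>s\<in>S. c s * f s h)"
  proof (rule insert.IH[OF \<open>subspace K\<close>])
    show "g h = 0" if "h \<in> K" "\<And>i. i \<in> S \<Longrightarrow> f i h = 0" for h
      by (rule insert.prems(6)) (use that in \<open>auto simp: K_def\<close>)
  qed (use lin in \<open>auto simp: K_def\<close>)
  then obtain c where c: "\<And>h. h \<in> K \<Longrightarrow> g h = (\<Sum>s\<in>S. c s * f s h)" by blast
  have sum_upd: "(\<Sum>i\<in>insert s S. (c(s := k)) i * f i h) = k * f s h + (\<Sum>i\<in>S. c i * f i h)" for k h
    using insert.hyps by (auto intro!: sum.cong)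
  show ?case
  proof (cases "\<forall>h\<in>H. f s h = 0")
    case True
    thus ?thesis using c sum_upd[of 0] by (intro exI[of _ "c(s := 0)"]) (auto simp: K_def)
  next
    case False
    then obtain h0 where h0: "h0 \<in> H" "f s h0 \<noteq> 0" by blast
    \<comment> \<open>Evaluating the claim at \<open>h0\<close> forces this coefficient; an
      arbitrary \<open>h\<close> is then moved into the kernel \<open>K\<close> by a multiple of
      \<open>h0\<close>.\<close>
    define k where "k = (g h0 - (\<Sum>i\<in>S. c i * f i h0)) / f s h0"
    have "g h = (\<Sum>i\<in>insert s S. (c(s := k)) i * f i h)" if "h \<in> H" for h
    proof -
      define r where "r = - (f s h / f s h0)"
      have sc: "scale r h0 \<in> H" using h0 H subspace_scale by blast
      hence "h + scale r h0 \<in> H" using that H subspace_add by blast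
      moreover have "f s (h + scale r h0) = f s h + r * f s h0" using lin(1,2) that sc h0 by simp
      hence "f s (h + scale r h0) = 0" using h0(2) by (simp add: r_def)
      ultimately have "g (h + scale r h0) = (\<Sum>i\<in>S. c i * f i (h + scale r h0))"
        by (intro c) (simp add: K_def)
      also have "\<dots> = (\<Sum>i\<in>S. c i * f i h + r * (c i * f i h0))"
        using lin(1,2) that sc h0 by (intro sum.cong) (auto simp: algebra_simps)
      finally have "g h + r * g h0 = (\<Sum>i\<in>S. c i * f i h) + r * (\<Sum>i\<in>S. c i * f i h0)"
        using lin(3,4) that sc h0 by (simp add: sum.distrib sum_distrib_left)
      hence "g h = k * f s h + (\<Sum>i\<in>S. c i * f i h)"
        using h0(2) by (simp add: r_def k_def field_simps)
      thus ?thesis unfolding sum_upd .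
    qed
    thus ?thesis by blast
  qed
qed

section \<open>Root strings in the Lie algebra\<close>

locale class_T_algebra =
  fixes smul :: "'a::field_char_0 \<Rightarrow> 'l::ab_group_add \<Rightarrow> 'l"
    and br :: "'l \<Rightarrow> 'l \<Rightarrow> 'l" and B :: "'l \<Rightarrow> 'l \<Rightarrow> 'a" and H :: "'l set"
  assumes class_T: "class_T smul br B H"
begin

lemma lie_algebra: "lie_algebra smul br" and form: "invariant_nondeg_form smul br B"
  and toral: "toral smul br H"
  and H_finite_span: "\<exists>S. finite S \<and> S \<subseteq> H \<and> module.span smul S = H"
  and H_nondegenerate: "\<forall>h\<in>H. (\<forall>h'\<in>H. B h h' = 0) \<longrightarrow> h = 0"
  and isotropic_pair: "\<forall>\<delta>\<in>roots0 smul br B H. \<exists>x\<in>rootspace smul br H \<delta>.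
          \<exists>y\<in>rootspace smul br H (\<lambda>h. - \<delta> h). br x y = tvec B H \<delta>"
  and nonisotropic_pair: "\<forall>\<alpha>\<in>rootsx smul br B H. \<forall>x\<in>rootspace smul br H \<alpha>. x \<noteq> 0 \<longrightarrow>
          (\<exists>y\<in>rootspace smul br H (\<lambda>h. - \<alpha> h). br x y = tvec B H \<alpha>)"
  and ad_nilpotent: "\<forall>\<alpha>\<in>rootsx smul br B H. \<forall>x\<in>rootspace smul br H \<alpha>. \<forall>y. \<exists>n. (br x ^^ n) y = 0"
  and roots_irreducible: "\<not> (\<exists>A C. A \<noteq> {} \<and> C \<noteq> {} \<and> A \<inter> C = {} \<and> A \<union> C = rootsx smul br B H
             \<and> (\<forall>a\<in>A. \<forall>c\<in>C. hform B H a c = 0))"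
  and roots_nonisolated: "\<forall>\<delta>\<in>roots0 smul br B H. \<exists>\<alpha>\<in>rootsx smul br B H.
          (\<lambda>h. \<alpha> h + \<delta> h) \<in> roots smul br H"
  and isotropic_span: "free_abelian_finite_rank (int_span (roots0 smul br B H))"
  using class_T unfolding class_T_def by - (elim conjE, assumption)+

sublocale vector_space smul
  using lie_algebra unfolding lie_algebra_def by blast

lemma br_add_left: "br (x + y) z = br x z + br y z"
  and br_add_right: "br x (y + z) = br x y + br x z"
  and br_smul_left: "br (smul c x) y = smul c (br x y)"
  and br_smul_right: "br x (smul c y) = smul c (br x y)"
  and br_self: "br x x = 0"
  and jacobi: "br x (br y z) + br y (br z x) + br z (br x y) = 0"
  using lie_algebra unfolding lie_algebra_def by simp_all

lemma B_add_left: "B (x + y) z = B x z + B y z"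
  and B_smul_left: "B (smul c x) y = c * B x y"
  and B_sym: "B x y = B y x"
proof -
  note form = form[unfolded invariant_nondeg_form_def]
  show "B (x + y) z = B x z + B y z" using form[THEN conjunct1] by simp
  show "B (smul c x) y = c * B x y" using form[THEN conjunct2, THEN conjunct1] by simp
  show "B x y = B y x" using form[THEN conjunct2, THEN conjunct2, THEN conjunct1] by simp
qed

lemma B_add_right: "B z (x + y) = B z x + B z y"
  by (metis B_add_left B_sym)

lemma B_smul_right: "B z (smul c x) = c * B z x"
  by (metis B_smul_left B_sym)

lemma B_minus_left: "B (- x) z = - B x z"
  using B_smul_left[of "-1" x z] by simp

lemma B_diff_left: "B (x - y) z = B x z - B y z"
  using B_add_left[of x "- y" z] by (simp add: B_minus_left)

lemma B_zero_left: "B 0 z = 0"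
  using B_smul_left[of 0 0 z] by simp

lemma H_subspace: "subspace H"
  using toral unfolding toral_def by blast

lemma br_zero_right: "br x 0 = 0"
  using br_add_right[of x 0 0] by simp

lemma br_anticomm: "br x y = - br y x"
proof -
  have "br (x + y) (x + y) = br x y + br y x"
    unfolding br_add_left br_add_right by (simp add: br_self)
  hence "br x y + br y x = 0" using br_self by metis
  thus ?thesis by (simp add: eq_neg_iff_add_eq_0)
qed

lemma br_derivation: "br x (br y z) = br (br x y) z + br y (br x z)"
proof -
  have "br y (- u) = - br y u" for u using br_smul_right[of y "-1" u] by simp
  hence "br y (br z x) = - br y (br x z)" using br_anticomm[of z x] by simp
  thus ?thesis using jacobi[of x y z] br_anticomm[of z "br x y"] by (simp add: algebra_simps)
qed

section \<open>Representing functionals on the toral subalgebra by vectors\<close>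

lemma Hdual_add: "\<alpha> \<in> Hdual smul H \<Longrightarrow> \<beta> \<in> Hdual smul H \<Longrightarrow> (\<lambda>h. \<alpha> h + \<beta> h) \<in> Hdual smul H"
  by (auto simp: Hdual_def algebra_simps)

lemma Hdual_scale: "\<alpha> \<in> Hdual smul H \<Longrightarrow> (\<lambda>h. c * \<alpha> h) \<in> Hdual smul H"
  by (auto simp: Hdual_def algebra_simps)

lemma tvec_unique:
  assumes "t \<in> H" "\<And>h. h \<in> H \<Longrightarrow> B t h = \<alpha> h"
  shows "tvec B H \<alpha> = t"
  unfolding tvec_def
proof (rule the_equality)
  fix t' assume t': "t' \<in> H \<and> (\<forall>h\<in>H. B t' h = \<alpha> h)"
  hence "t' - t \<in> H" using assms H_subspace subspace_diff by blast
  moreover have "B (t' - t) h = 0" if "h \<in> H" for h using that t' assms by (simp add: B_diff_left)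
  ultimately show "t' = t" using H_nondegenerate by force
qed (use assms in auto)

lemma tvec:
  assumes "\<alpha> \<in> Hdual smul H"
  shows tvec_mem: "tvec B H \<alpha> \<in> H" and tvec_form: "h \<in> H \<Longrightarrow> B (tvec B H \<alpha>) h = \<alpha> h"
proof -
  obtain S where S: "finite S" "S \<subseteq> H" "span S = H" using H_finite_span by blast
  have ker: "\<alpha> h = 0" if "h \<in> H" "\<And>s. s \<in> S \<Longrightarrow> B s h = 0" for h
  proof -
    have "subspace {x. B x h = 0}"
      by (intro subspaceI) (auto simp: B_add_left B_smul_left B_zero_left)
    hence "span S \<subseteq> {x. B x h = 0}" using that(2) by (intro span_minimal) auto
    hence "\<forall>h'\<in>H. B h h' = 0" using S(3) B_sym[of h] by auto
    hence "h = 0" using H_nondegenerate that(1) by blast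
    moreover have "\<alpha> (smul 0 0) = 0 * \<alpha> 0"
      using assms subspace_0[OF H_subspace] unfolding Hdual_def by blast
    ultimately show ?thesis by simp
  qed
  have "\<exists>c. \<forall>h\<in>H. \<alpha> h = (\<Sum>s\<in>S. c s * B s h)"
    by (rule functional_combination[OF S(1) H_subspace])
      (use assms ker in \<open>auto simp: Hdual_def B_add_right B_smul_right\<close>)
  then obtain c where c: "\<And>h. h \<in> H \<Longrightarrow> \<alpha> h = (\<Sum>s\<in>S. c s * B s h)" by blast
  define t where "t = (\<Sum>s\<in>S. smul (c s) s)"
  have t: "t \<in> H" unfolding t_def using S(2) H_subspace by (intro subspace_sum subspace_scale) auto
  have "B t h = (\<Sum>s\<in>S. c s * B s h)" for h
    unfolding t_def using S(1)
    by (induction S rule: finite_induct) (auto simp: B_zero_left B_add_left B_smul_left)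
  hence "tvec B H \<alpha> = t" "\<And>h. h \<in> H \<Longrightarrow> B t h = \<alpha> h" using c t tvec_unique by auto
  thus "tvec B H \<alpha> \<in> H" "h \<in> H \<Longrightarrow> B (tvec B H \<alpha>) h = \<alpha> h" using t by auto
qed

lemma tvec_add:
  assumes "\<alpha> \<in> Hdual smul H" "\<beta> \<in> Hdual smul H"
  shows "tvec B H (\<lambda>h. \<alpha> h + \<beta> h) = tvec B H \<alpha> + tvec B H \<beta>"
  using assms H_subspace by (intro tvec_unique) (auto simp: B_add_left tvec subspace_add)

lemma tvec_scale:
  assumes "\<alpha> \<in> Hdual smul H"
  shows "tvec B H (\<lambda>h. c * \<alpha> h) = smul c (tvec B H \<alpha>)"
  using assms H_subspace by (intro tvec_unique) (auto simp: B_smul_left tvec subspace_scale)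

lemma tvec_inject:
  assumes "\<alpha> \<in> Hdual smul H" "\<beta> \<in> Hdual smul H" "tvec B H \<alpha> = tvec B H \<beta>"
  shows "\<alpha> = \<beta>"
proof
  fix h show "\<alpha> h = \<beta> h"
    using assms tvec_form by (cases "h \<in> H") (metis, simp add: Hdual_def)
qed

lemma tvec_surj:
  assumes "t \<in> H"
  obtains \<alpha> where "\<alpha> \<in> Hdual smul H" "tvec B H \<alpha> = t"
proof (rule that[of "\<lambda>h. if h \<in> H then B t h else 0"])
  show "(\<lambda>h. if h \<in> H then B t h else 0) \<in> Hdual smul H"
    using H_subspace by (auto simp: Hdual_def B_add_right B_smul_right subspace_add subspace_scale)
qed (use assms in \<open>auto intro!: tvec_unique\<close>)

text \<open>Weights and roots are encoded by the vectors \<open>t\<^sub>\<alpha> \<in> H\<close> instead of functionals, so that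
  the form on roots is \<open>B\<close> itself.\<close>

definition wspace :: "'l \<Rightarrow> 'l set" where
  "wspace t = {x. \<forall>h\<in>H. br h x = smul (B t h) x}"

definition troots :: "'l set" where
  "troots = tvec B H ` roots smul br H"

lemma rootspace_eq_wspace:
  "\<alpha> \<in> Hdual smul H \<Longrightarrow> rootspace smul br H \<alpha> = wspace (tvec B H \<alpha>)"
  by (auto simp: rootspace_def wspace_def tvec_form)

lemma roots_Hdual: "\<alpha> \<in> roots smul br H \<Longrightarrow> \<alpha> \<in> Hdual smul H"
  by (simp add: roots_def)

lemma roots_iff:
  assumes "\<alpha> \<in> Hdual smul H"
  shows "\<alpha> \<in> roots smul br H \<longleftrightarrow> tvec B H \<alpha> \<in> troots"
  using assms tvec_inject roots_Hdual by (auto simp: troots_def)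

lemma zero_in_wspace: "0 \<in> wspace t"
  by (simp add: wspace_def br_zero_right)

lemma troots_iff: "t \<in> troots \<longleftrightarrow> t \<in> H \<and> (\<exists>x\<in>wspace t. x \<noteq> 0)"
proof
  assume "t \<in> troots"
  then obtain \<alpha> where \<alpha>: "\<alpha> \<in> roots smul br H" "t = tvec B H \<alpha>" by (auto simp: troots_def)
  hence "\<alpha> \<in> Hdual smul H" "wspace t \<noteq> {0}"
    using rootspace_eq_wspace[of \<alpha>] by (auto simp: roots_def)
  thus "t \<in> H \<and> (\<exists>x\<in>wspace t. x \<noteq> 0)" using tvec_mem zero_in_wspace[of t] \<alpha>(2) by blast
next
  assume t: "t \<in> H \<and> (\<exists>x\<in>wspace t. x \<noteq> 0)"
  then obtain \<alpha> where \<alpha>: "\<alpha> \<in> Hdual smul H" "tvec B H \<alpha> = t" using tvec_surj by blast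
  moreover from this have "rootspace smul br H \<alpha> \<noteq> {0}" using t by (auto simp: rootspace_eq_wspace)
  ultimately show "t \<in> troots" by (auto simp: troots_def roots_def)
qed

lemma wspace_br:
  assumes "x \<in> wspace t" "v \<in> wspace u"
  shows "br x v \<in> wspace (t + u)"
  unfolding wspace_def
proof (intro CollectI ballI)
  fix h assume "h \<in> H"
  hence "br h x = smul (B t h) x" "br h v = smul (B u h) v" using assms by (auto simp: wspace_def)
  thus "br h (br x v) = smul (B (t + u) h) (br x v)"
    by (simp add: br_derivation[of h] br_smul_left br_smul_right B_add_left scale_left_distrib)
qed

lemma wspace_br_power:
  assumes "x \<in> wspace t" "v \<in> wspace u"
  shows "(br x ^^ n) v \<in> wspace (u + smul (of_nat n) t)"
proof (induction n)
  case (Suc n)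
  have eq: "u + smul (of_nat (Suc n)) t = t + (u + smul (of_nat n) t)"
    by (simp add: scale_left_distrib algebra_simps)
  show ?case unfolding eq using wspace_br[OF assms(1) Suc] by simp
qed (use assms in simp)

lemma troots_isotropic:
  assumes "t \<in> troots" "B t t = 0"
  obtains x y where "x \<in> wspace t" "y \<in> wspace (- t)" "br x y = t"
proof -
  obtain \<delta> where \<delta>: "\<delta> \<in> roots smul br H" "t = tvec B H \<delta>" using assms(1) by (auto simp: troots_def)
  have d: "\<delta> \<in> Hdual smul H" by (rule roots_Hdual[OF \<delta>(1)])
  hence neg: "(\<lambda>h. - \<delta> h) \<in> Hdual smul H" "tvec B H (\<lambda>h. - \<delta> h) = - t"
    using Hdual_scale[of \<delta> "-1"] tvec_scale[of \<delta> "-1"] \<delta>(2) by simp_all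
  have "\<delta> \<in> roots0 smul br B H" using \<delta> assms(2) by (simp add: roots0_def hform_def)
  hence "\<exists>x\<in>rootspace smul br H \<delta>. \<exists>y\<in>rootspace smul br H (\<lambda>h. - \<delta> h). br x y = tvec B H \<delta>"
    using isotropic_pair by blast
  thus ?thesis using that unfolding rootspace_eq_wspace[OF d] rootspace_eq_wspace[OF neg(1)] neg(2) \<delta>(2)[symmetric]
    by blast
qed

lemma troots_nonisotropic:
  assumes "t \<in> troots" "B t t \<noteq> 0" "x \<in> wspace t"
  shows "x \<noteq> 0 \<Longrightarrow> \<exists>y\<in>wspace (- t). br x y = t" and "\<exists>n. (br x ^^ n) v = 0"
proof -
  obtain \<delta> where \<delta>: "\<delta> \<in> roots smul br H" "t = tvec B H \<delta>" using assms(1) by (auto simp: troots_def)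
  have d: "\<delta> \<in> Hdual smul H" by (rule roots_Hdual[OF \<delta>(1)])
  hence neg: "(\<lambda>h. - \<delta> h) \<in> Hdual smul H" "tvec B H (\<lambda>h. - \<delta> h) = - t"
    using Hdual_scale[of \<delta> "-1"] tvec_scale[of \<delta> "-1"] \<delta>(2) by simp_all
  have \<delta>x: "\<delta> \<in> rootsx smul br B H" using \<delta> assms(2) by (simp add: rootsx_def hform_def)
  have x: "x \<in> rootspace smul br H \<delta>" using assms(3) d \<delta>(2) by (simp add: rootspace_eq_wspace)
  have "x \<noteq> 0 \<longrightarrow> (\<exists>y\<in>rootspace smul br H (\<lambda>h. - \<delta> h). br x y = tvec B H \<delta>)"
    using nonisotropic_pair \<delta>x x by blast
  thus "x \<noteq> 0 \<Longrightarrow> \<exists>y\<in>wspace (- t). br x y = t"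
    unfolding rootspace_eq_wspace[OF neg(1)] neg(2) \<delta>(2)[symmetric] by blast
  show "\<exists>n. (br x ^^ n) v = 0"
    using ad_nilpotent \<delta>x x by blast
qed

text \<open>Both halves of (T3) write a nonzero \<open>t\<close> as a bracket with a factor in
  \<open>wspace (- t)\<close>, and that factor cannot vanish.\<close>

lemma troots_neg: "t \<in> troots \<Longrightarrow> - t \<in> troots"
proof (cases "t = 0")
  case False
  assume t: "t \<in> troots"
  have "\<exists>x. \<exists>y\<in>wspace (- t). br x y = t"
  proof (cases "B t t = 0")
    case True
    from troots_isotropic[OF t True] show ?thesis by metis
  next
    case False
    thus ?thesis using troots_nonisotropic(1)[OF t False] t unfolding troots_iff by blast
  qed
  then obtain y where "y \<in> wspace (- t)" "y \<noteq> 0" using False br_zero_right by fastforce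
  thus ?thesis using t H_subspace subspace_neg by (auto simp: troots_iff)
qed simp

text \<open>Covers both \<open>sl\<^sub>2\<close>-triples (\<open>B t t \<noteq> 0\<close>) and Heisenberg triples (\<open>B t t = 0\<close>).\<close>

lemma ladder:
  assumes "t \<in> H" "x \<in> wspace t" "y \<in> wspace (- t)" "br x y = t" "w \<in> wspace u" "br x w = 0"
  shows "br x ((br y ^^ Suc j) w) =
    smul (of_nat (Suc j) * (B u t - of_nat j * B t t / 2)) ((br y ^^ j) w)"
proof (induction j)
  case 0
  show ?case using assms br_derivation[of x y w] by (auto simp: wspace_def br_zero_right)
next
  case (Suc j)
  define z where "z = (br y ^^ Suc j) w"
  have "z \<in> wspace (u + smul (of_nat (Suc j)) (- t))"
    unfolding z_def by (rule wspace_br_power[OF assms(3,5)])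
  hence "br t z = smul (B (u + smul (of_nat (Suc j)) (- t)) t) z"
    using assms(1) unfolding wspace_def by blast
  hence tz: "br t z = smul (B u t - of_nat (Suc j) * B t t) z"
    by (simp only: B_add_left B_smul_left B_minus_left) simp
  have "br x ((br y ^^ Suc (Suc j)) w) = br x (br y z)" by (simp add: z_def)
  also have "\<dots> = br t z + br y (br x z)" using br_derivation[of x y z] assms(4) by simp
  also have "br y (br x z) = smul (of_nat (Suc j) * (B u t - of_nat j * B t t / 2)) z"
    using Suc by (simp add: z_def br_smul_right del: of_nat_Suc)
  also have "br t z + \<dots> = smul ((B u t - of_nat (Suc j) * B t t)
      + of_nat (Suc j) * (B u t - of_nat j * B t t / 2)) z"
    unfolding tz by (simp add: scale_left_distrib)
  also have "(B u t - of_nat (Suc j) * B t t) + of_nat (Suc j) * (B u t - of_nat j * B t t / 2)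
      = of_nat (Suc (Suc j)) * (B u t - of_nat (Suc j) * B t t / 2)"
    by (simp add: field_simps)
  finally show ?case unfolding z_def .
qed

lemma last_nonzero_power:
  assumes "v \<noteq> 0" "(br x ^^ n) v = 0"
  obtains k where "k < n" "(br x ^^ k) v \<noteq> 0" "br x ((br x ^^ k) v) = 0"
proof -
  define N where "N = (LEAST n. (br x ^^ n) v = 0)"
  have N: "(br x ^^ N) v = 0" "N \<le> n" unfolding N_def using assms(2) by (auto intro: LeastI Least_le)
  then obtain k where k: "N = Suc k" using assms(1) by (cases N) auto
  hence "(br x ^^ k) v \<noteq> 0" using not_less_Least[of k "\<lambda>n. (br x ^^ n) v = 0"] by (simp add: N_def)
  thus ?thesis using that[of k] N k by simp
qed

text \<open>Climbing \<open>k\<close> steps with \<open>x\<close> reaches a highest vector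
  \<open>w\<close>, and \<open>N\<close> steps down with \<open>y\<close> are possible from there.
  At the bottom the ladder factor must vanish, which gives the Cartan number \<open>N - 2 k\<close>.
  The vectors \<open>y^j w\<close> with \<open>j \<le> N\<close> are nonzero, and
  \<open>j = i + k\<close> yields the weight \<open>u - i t\<close>.\<close>

lemma troots_descend:
  assumes t: "t \<in> troots" "B t t \<noteq> 0" and u: "u \<in> troots"
  shows "\<exists>m::int. 2 * B u t = of_int m * B t t
        \<and> (\<forall>i. 0 \<le> i \<and> i \<le> m \<longrightarrow> u - smul (of_int i) t \<in> troots)"
proof -
  have H: "t \<in> H" "u \<in> H" using t u by (auto simp: troots_iff)
  obtain v where v: "v \<in> wspace u" "v \<noteq> 0" using u by (auto simp: troots_iff)
  obtain x where x: "x \<in> wspace t" "x \<noteq> 0" using t by (auto simp: troots_iff)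
  obtain y where y: "y \<in> wspace (- t)" "br x y = t" using troots_nonisotropic(1)[OF t x] by blast
  obtain k where k: "(br x ^^ k) v \<noteq> 0" "br x ((br x ^^ k) v) = 0"
    using troots_nonisotropic(2)[OF t x(1), of v] last_nonzero_power[OF v(2)] by metis
  define w where "w = (br x ^^ k) v"
  have w: "w \<in> wspace (u + smul (of_nat k) t)" "w \<noteq> 0" "br x w = 0"
    using wspace_br_power[OF x(1) v(1)] k by (auto simp: w_def)
  have nt: "- t \<in> troots" "B (- t) (- t) \<noteq> 0"
    using troots_neg t B_sym[of t "- t"] by (auto simp: B_minus_left)
  obtain N where N: "(br y ^^ N) w \<noteq> 0" "br y ((br y ^^ N) w) = 0"
    using troots_nonisotropic(2)[OF nt y(1), of w] last_nonzero_power[OF w(2)] by metis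
  have "smul (of_nat (Suc N) * (B (u + smul (of_nat k) t) t - of_nat N * B t t / 2)) ((br y ^^ N) w)
      = br x ((br y ^^ Suc N) w)"
    by (rule ladder[OF H(1) x(1) y w(1,3), symmetric])
  also have "\<dots> = 0" using N(2) by (simp add: br_zero_right)
  finally have "B (u + smul (of_nat k) t) t = of_nat N * B t t / 2"
    using N(1) by (simp del: of_nat_Suc)
  hence 1: "2 * B u t = of_int (int N - 2 * int k) * B t t"
    by (simp add: B_add_left B_smul_left field_simps)
  have 2: "u - smul (of_int i) t \<in> troots" if i: "0 \<le> i" "i \<le> int N - 2 * int k" for i
  proof -
    define j where "j = nat i + k"
    have "j \<le> N" using i by (simp add: j_def)
    have "(br y ^^ j) w \<noteq> 0"
    proof
      assume "(br y ^^ j) w = 0"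
      moreover have "(br y ^^ n) 0 = 0" for n by (induction n) (auto simp: br_zero_right)
      moreover have "(br y ^^ N) w = (br y ^^ (N - j)) ((br y ^^ j) w)"
        using \<open>j \<le> N\<close> by (metis comp_apply funpow_add le_add_diff_inverse2)
      ultimately show False using N(1) by simp
    qed
    moreover have eq: "u + smul (of_nat k) t + smul (of_nat j) (- t) = u - smul (of_int i) t"
    proof -
      have "(of_nat j :: 'a) = of_int i + of_nat k"
        using i(1) by (simp add: j_def)
      thus ?thesis by (simp add: scale_left_distrib)
    qed
    have "(br y ^^ j) w \<in> wspace (u - smul (of_int i) t)"
      using wspace_br_power[OF y(1) w(1), of j] unfolding eq .
    moreover have "u - smul (of_int i) t \<in> H" using H H_subspace by (intro subspace_diff subspace_scale)
    ultimately show ?thesis by (auto simp: troots_iff)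
  qed
  show ?thesis by (intro exI[of _ "int N - 2 * int k"] conjI allI impI 1 2) auto
qed

text \<open>A Heisenberg triple whose centre acts as a nonzero scalar has no finite-dimensional modules, so
  \<open>u + n \<delta>\<close> would be a root for some \<open>n = \<plusminus>3\<close>, which integrality forbids.\<close>

lemma isotropic_orthogonal_nonisotropic:
  assumes d: "\<delta> \<in> troots" "B \<delta> \<delta> = 0" and u: "u \<in> troots" "B u u \<noteq> 0"
  shows "B \<delta> u = 0"
proof (rule ccontr)
  assume c: "B \<delta> u \<noteq> 0"
  have H: "\<delta> \<in> H" "u \<in> H" using d u by (auto simp: troots_iff)
  obtain x y where xy: "x \<in> wspace \<delta>" "y \<in> wspace (- \<delta>)" "br x y = \<delta>"
    using troots_isotropic[OF d] .
  obtain v where v: "v \<in> wspace u" "v \<noteq> 0" using u by (auto simp: troots_iff)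
  have "\<exists>n::int. \<bar>n\<bar> = 3 \<and> u + smul (of_int n) \<delta> \<in> troots"
  proof (cases "(br x ^^ 3) v = 0")
    case False
    moreover have "(br x ^^ 3) v \<in> wspace (u + smul (of_nat 3) \<delta>)"
      by (rule wspace_br_power[OF xy(1) v(1)])
    moreover have "u + smul (of_nat 3) \<delta> \<in> H" using H H_subspace by (intro subspace_add subspace_scale)
    ultimately have "u + smul (of_nat 3) \<delta> \<in> troots" unfolding troots_iff by blast
    thus ?thesis by (intro exI[of _ 3]) simp
  next
    case True
    then obtain k where k: "(br x ^^ k) v \<noteq> 0" "br x ((br x ^^ k) v) = 0"
      using last_nonzero_power[OF v(2)] by metis
    define w where "w = (br x ^^ k) v"
    have w: "w \<in> wspace (u + smul (of_nat k) \<delta>)" "w \<noteq> 0" "br x w = 0"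
      using wspace_br_power[OF xy(1) v(1)] k by (auto simp: w_def)
    \<comment> \<open>As \<open>B \<delta> \<delta> = 0\<close>, the ladder factor is
      \<open>Suc j\<close> times \<open>B u \<delta>\<close>, never 0 in characteristic 0: once the
      ascent stops, the descent cannot.\<close>
    have nz: "(br y ^^ j) w \<noteq> 0" for j
    proof (induction j)
      case (Suc j)
      have "br x ((br y ^^ Suc j) w) = smul (of_nat (Suc j) * B u \<delta>) ((br y ^^ j) w)"
        using ladder[OF H(1) xy w(1,3), of j] d(2) by (simp add: B_add_left B_smul_left)
      hence "br x ((br y ^^ Suc j) w) \<noteq> 0" using Suc c B_sym[of u \<delta>] by (simp del: of_nat_Suc)
      thus ?case using br_zero_right by metis
    qed (use w in simp)
    \<comment> \<open>The vector \<open>w\<close> sits \<open>k\<close> steps above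
      \<open>u\<close>, so \<open>k + 3\<close> steps down end at
      \<open>u - 3 \<delta>\<close>.\<close>
    have "u + smul (of_nat k) \<delta> + smul (of_nat (k + 3)) (- \<delta>) = u + smul (of_int (- 3)) \<delta>"
      by (simp add: scale_left_distrib)
    moreover have "u + smul (of_int (- 3)) \<delta> \<in> H" using H H_subspace by (intro subspace_add subspace_scale)
    ultimately have "u + smul (of_int (- 3)) \<delta> \<in> troots"
      unfolding troots_iff using nz[of "k + 3"] wspace_br_power[OF xy(2) w(1), of "k + 3"] by metis
    thus ?thesis by (intro exI[of _ "-3"]) simp
  qed
  then obtain n :: int where n: "\<bar>n\<bar> = 3" and g: "u + smul (of_int n) \<delta> \<in> troots" (is "?g \<in> _") by blast
  obtain m where m: "2 * B \<delta> u = of_int m * B u u" using troots_descend[OF u d(1)] by blast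
  have "m \<noteq> 0" using m c by auto
  have gg: "B ?g ?g = of_int (1 + n * m) * B u u"
  proof -
    have "B ?g ?g = B u u + of_int n * (2 * B \<delta> u)"
      using d(2) B_sym[of u \<delta>] by (simp add: B_add_left B_add_right B_smul_left B_smul_right)
    thus ?thesis unfolding m by (simp add: algebra_simps)
  qed
  \<comment> \<open>Integrality of the Cartan number of \<open>u\<close> against
    \<open>u + n \<delta>\<close> requires \<open>1 + n m\<close> to divide \<open>2 + n m\<close>,
    hence to divide 1. The choice of 3 excludes this: \<open>n m\<close> is a nonzero multiple of 3,
    so \<open>1 + n m\<close> is none of -1, 0, 1, whereas \<open>n\<close> of absolute value 1 or 2
    would leave \<open>n m = -2\<close> possible.\<close>
  have "n = 3 \<or> n = -3" using n by linarith
  hence nm: "1 + n * m \<noteq> 0" and nm1: "1 + n * m \<noteq> 1 \<and> 1 + n * m \<noteq> - 1"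
    using \<open>m \<noteq> 0\<close> by (elim disjE; hypsubst; presburger)+
  have gg0: "B ?g ?g \<noteq> 0"
  proof -
    have "(of_int (1 + n * m) :: 'a) \<noteq> 0" using nm by (simp only: of_int_eq_0_iff not_False_eq_True)
    thus ?thesis unfolding gg using u(2) by simp
  qed
  then obtain k where "2 * B u ?g = of_int k * B ?g ?g" using troots_descend[OF g gg0 u(1)] by blast
  moreover have "2 * B u ?g = of_int (2 + n * m) * B u u"
  proof -
    have "2 * B u ?g = 2 * B u u + of_int n * (2 * B \<delta> u)"
      using B_sym[of u \<delta>] by (simp add: B_add_right B_smul_right)
    thus ?thesis unfolding m by (simp add: algebra_simps)
  qed
  ultimately have "of_int (2 + n * m) * B u u = of_int (k * (1 + n * m)) * B u u"
    unfolding gg by simp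
  hence "(of_int (2 + n * m) :: 'a) = of_int (k * (1 + n * m))" using u(2) mult_right_cancel by blast
  hence "2 + n * m = k * (1 + n * m)" by (simp only: of_int_eq_iff)
  hence "1 = (k - 1) * (1 + n * m)" by (simp add: algebra_simps)
  hence "(1 + n * m) dvd 1" by (metis dvd_triv_right)
  hence "\<bar>1 + n * m\<bar> = 1" by (simp only: zdvd1_eq)
  thus False using nm1 by linarith
qed

lemma troots_nonisolated:
  assumes "\<delta> \<in> troots" "B \<delta> \<delta> = 0"
  shows "\<exists>t\<in>troots. B t t \<noteq> 0 \<and> t + \<delta> \<in> troots"
proof -
  obtain d where d: "d \<in> roots smul br H" "\<delta> = tvec B H d" using assms(1) by (auto simp: troots_def)
  hence "d \<in> roots0 smul br B H" using assms(2) by (simp add: roots0_def hform_def)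
  then obtain \<alpha> where \<alpha>: "\<alpha> \<in> rootsx smul br B H" "(\<lambda>h. \<alpha> h + d h) \<in> roots smul br H"
    using roots_nonisolated by blast
  hence a: "\<alpha> \<in> roots smul br H" "B (tvec B H \<alpha>) (tvec B H \<alpha>) \<noteq> 0"
    by (auto simp: rootsx_def hform_def)
  show ?thesis
  proof (intro bexI[of _ "tvec B H \<alpha>"] conjI)
    show "tvec B H \<alpha> + \<delta> \<in> troots"
      using \<alpha>(2) d tvec_add[OF roots_Hdual[OF a(1)] roots_Hdual[OF d(1)]]
      unfolding troots_def by (metis imageI)
  qed (use a in \<open>auto simp: troots_def\<close>)
qed

text \<open>For isotropic \<open>u\<close>, nonisolation gives a nonisotropic \<open>t\<close> with
  \<open>t + u\<close> a root. Since \<open>u\<close> is orthogonal to \<open>t\<close>, the root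
  \<open>t + u\<close> is nonisotropic as well, and \<delta> is orthogonal to both, hence to their
  difference \<open>u\<close>.\<close>

lemma isotropic_orthogonal:
  assumes d: "\<delta> \<in> troots" "B \<delta> \<delta> = 0" and u: "u \<in> troots"
  shows "B \<delta> u = 0"
proof (cases "B u u = 0")
  case False
  thus ?thesis using isotropic_orthogonal_nonisotropic assms by blast
next
  case True
  then obtain t where t: "t \<in> troots" "B t t \<noteq> 0" "t + u \<in> troots" using troots_nonisolated u by blast
  have "B u t = 0" by (rule isotropic_orthogonal_nonisotropic[OF u True t(1,2)])
  hence "B (t + u) (t + u) \<noteq> 0" using t(2) True B_sym[of t u] by (simp add: B_add_left B_add_right)
  hence "B \<delta> (t + u) = 0" "B \<delta> t = 0" using isotropic_orthogonal_nonisotropic d t by blast+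
  thus ?thesis by (simp add: B_add_right)
qed

lemma roots_not_decomposable:
  assumes "A \<noteq> {}" "C \<noteq> {}" "A \<inter> C = {}" "A \<union> C = rootsx smul br B H"
    and "\<forall>a\<in>A. \<forall>c\<in>C. hform B H a c = 0"
  shows False
  by (rule notE[OF roots_irreducible]) (rule exI[of _ A], rule exI[of _ C], intro conjI assms)

lemma root_datum_troots:
  assumes "\<exists>\<alpha>0\<in>rootsx smul br B H. hform B H \<alpha>0 \<alpha>0 = 1"
  shows "root_datum smul B troots"
proof
  show "\<not> (\<exists>A C. A \<noteq> {} \<and> C \<noteq> {} \<and> A \<inter> C = {} \<and> A \<union> C = {t \<in> troots. B t t \<noteq> 0}
      \<and> (\<forall>a\<in>A. \<forall>c\<in>C. B a c = 0))"
  proof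
    assume "\<exists>A C. A \<noteq> {} \<and> C \<noteq> {} \<and> A \<inter> C = {} \<and> A \<union> C = {t \<in> troots. B t t \<noteq> 0}
      \<and> (\<forall>a\<in>A. \<forall>c\<in>C. B a c = 0)"
    then obtain A C where AC: "A \<noteq> {}" "C \<noteq> {}" "A \<inter> C = {}" "A \<union> C = {t \<in> troots. B t t \<noteq> 0}"
      "\<forall>a\<in>A. \<forall>c\<in>C. B a c = 0" by blast
    let ?p = "\<lambda>A. {\<alpha> \<in> roots smul br H. tvec B H \<alpha> \<in> A}"
    have "A \<subseteq> troots" "C \<subseteq> troots" using AC(4) by auto
    hence "?p A \<noteq> {}" "?p C \<noteq> {}" using AC(1,2) unfolding troots_def by blast+
    moreover have "?p A \<inter> ?p C = {}" using AC(3) by blast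
    moreover have "?p A \<union> ?p C = rootsx smul br B H"
      using AC(4) by (auto simp: rootsx_def hform_def troots_def)
    moreover have "\<forall>a\<in>?p A. \<forall>c\<in>?p C. hform B H a c = 0" using AC(5) by (auto simp: hform_def)
    ultimately show False by (rule roots_not_decomposable)
  qed
  show "\<exists>\<alpha>\<in>troots. B \<alpha> \<alpha> = 1" using assms by (auto simp: rootsx_def hform_def troots_def)
  show "\<exists>S. finite S \<and> troots \<subseteq> span S" using H_finite_span by (metis subsetI troots_iff)
qed (fact B_add_left B_smul_left B_sym troots_neg troots_descend isotropic_orthogonal
    troots_nonisolated)+

end

section \<open>Rational span and scalar extension\<close>

text \<open>Makes the functions a rational vector space, so that \<open>rat_span\<close> becomes an
  ordinary span and arguments by subspaces apply.\<close>

definition rat_scale :: "rat \<Rightarrow> ('l \<Rightarrow> 'a::field_char_0) \<Rightarrow> 'l \<Rightarrow> 'a" where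
  "rat_scale q f = (\<lambda>h. of_rat q * f h)"

interpretation ratfun: vector_space "rat_scale :: rat \<Rightarrow> ('l \<Rightarrow> 'a::field_char_0) \<Rightarrow> _"
  by unfold_locales (auto simp: rat_scale_def fun_eq_iff of_rat_add of_rat_mult algebra_simps)

lemma sum_rat_scale: "(\<Sum>b\<in>S. rat_scale (c b) b) = (\<lambda>h. \<Sum>b\<in>S. of_rat (c b) * b h)"
  by (induction S rule: infinite_finite_induct) (auto simp: rat_scale_def fun_eq_iff)

lemma rat_span_eq_span: "rat_span X = ratfun.span X"
  unfolding rat_span_def ratfun.span_explicit sum_rat_scale by blast

lemma int_span_subset_rat_span: "int_span X \<subseteq> rat_span X"
proof
  fix f assume "f \<in> int_span X"
  then obtain S c where "finite S" "S \<subseteq> X" "f = (\<lambda>h. \<Sum>b\<in>S. of_int (c b) * b h)"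
    by (auto simp: int_span_def)
  moreover from this have "f = (\<lambda>h. \<Sum>b\<in>S. of_rat (of_int (c b)) * b h)" by simp
  ultimately show "f \<in> rat_span X" unfolding rat_span_def
    by (intro CollectI exI[of _ S] exI[of _ "\<lambda>b. of_int (c b)"] conjI)
qed

lemma int_span_base: "x \<in> X \<Longrightarrow> x \<in> int_span X"
  unfolding int_span_def by (intro CollectI exI[of _ "{x}"] exI[of _ "\<lambda>_. 1"]) auto

lemma common_denominator:
  fixes c :: "'b \<Rightarrow> rat"
  assumes "finite S"
  shows "\<exists>(D::int) n. D \<noteq> 0 \<and> (\<forall>b\<in>S. c b * of_int D = of_int (n b))"
  using assms
proof (induction S rule: finite_induct)
  case empty
  show ?case by (intro exI[of _ 1]) auto
next
  case (insert x S)
  then obtain D n where D: "D \<noteq> 0" "\<And>b. b \<in> S \<Longrightarrow> c b * of_int D = of_int (n b)" by blast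
  obtain p q where pq: "c x = of_int p / of_int q" "q > 0"
    by (metis quotient_of_div quotient_of_denom_pos surj_pair)
  have "c b * of_int (D * q) = of_int ((if b = x then D * p else n b * q))" if "b \<in> insert x S" for b
    using that D(2)[of b] pq by (auto simp: field_simps)
  thus ?case using D(1) pq(2)
    by (intro exI[of _ "D * q"] exI[of _ "\<lambda>b. if b = x then D * p else n b * q"]) auto
qed

text \<open>Clearing denominators turns a rational relation into an integral one. This bridges (T6),
  which provides independence over the integers, and \<open>scalar_extension\<close>, which
  preserves independence over the rationals.\<close>

lemma rat_indep_if_int_indep:
  fixes X :: "('l \<Rightarrow> 'a::field_char_0) set"
  assumes fin: "finite X"
    and indep: "\<And>c. (\<lambda>h. \<Sum>b\<in>X. of_int (c b) * b h) = (\<lambda>h. 0) \<Longrightarrow> \<forall>b\<in>X. c b = 0"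
  shows "rat_indep X"
  unfolding rat_indep_def
proof (intro allI impI, elim conjE)
  fix S and c :: "('l \<Rightarrow> 'a) \<Rightarrow> rat"
  assume S: "finite S" "S \<subseteq> X" and z: "(\<lambda>h. \<Sum>b\<in>S. of_rat (c b) * b h) = (\<lambda>h. 0)"
  obtain D n where D: "D \<noteq> 0" "\<And>b. b \<in> S \<Longrightarrow> c b * of_int D = of_int (n b)"
    using common_denominator[OF S(1), of c] by blast
  have "(\<Sum>b\<in>X. of_int (if b \<in> S then n b else 0) * b h) = 0" for h
  proof -
    have "(\<Sum>b\<in>X. of_int (if b \<in> S then n b else 0) * b h) = (\<Sum>b\<in>S. of_int (n b) * b h)"
      using S(2) fin by (intro sum.mono_neutral_cong_right) auto
    also have "\<dots> = (\<Sum>b\<in>S. of_int D * (of_rat (c b) * b h))"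
    proof (rule sum.cong)
      fix b assume "b \<in> S"
      have "(of_int (n b) :: 'a) = of_rat (of_int (n b))" by simp
      also have "\<dots> = of_rat (c b) * of_int D" unfolding D(2)[OF \<open>b \<in> S\<close>, symmetric] by (simp add: of_rat_mult)
      finally show "of_int (n b) * b h = of_int D * (of_rat (c b) * b h)" by simp
    qed simp
    also have "\<dots> = 0" using fun_cong[OF z, of h] by (simp flip: sum_distrib_left)
    finally show ?thesis .
  qed
  hence "\<forall>b\<in>X. (if b \<in> S then n b else 0) = 0" by (intro indep) auto
  hence "n b = 0" if "b \<in> S" for b using that S(2) by (metis subsetD)
  thus "\<forall>b\<in>S. c b = 0" using D by force
qed

section \<open>The rational span of the roots\<close>

context class_T_algebra
begin

abbreviation VQ :: "('l \<Rightarrow> 'a) set" where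
  "VQ \<equiv> rat_span (roots smul br H)"

lemma roots_VQ: "\<alpha> \<in> roots smul br H \<Longrightarrow> \<alpha> \<in> VQ"
  unfolding rat_span_eq_span by (rule ratfun.span_base)

lemma VQ_Hdual: "\<alpha> \<in> VQ \<Longrightarrow> \<alpha> \<in> Hdual smul H"
proof -
  have "ratfun.subspace (Hdual smul H)"
    using Hdual_add Hdual_scale
    by (intro ratfun.subspaceI) (auto simp: rat_scale_def plus_fun_def Hdual_def zero_fun_def)
  hence "ratfun.span (roots smul br H) \<subseteq> Hdual smul H"
    by (intro ratfun.span_minimal) (auto intro: roots_Hdual)
  thus "\<alpha> \<in> VQ \<Longrightarrow> \<alpha> \<in> Hdual smul H" unfolding rat_span_eq_span by blast
qed

lemma tvec_plus: "\<alpha> \<in> Hdual smul H \<Longrightarrow> \<beta> \<in> Hdual smul H \<Longrightarrow>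
    tvec B H (\<alpha> + \<beta>) = tvec B H \<alpha> + tvec B H \<beta>"
  using tvec_add by (simp add: plus_fun_def)

lemma tvec_rat_scale: "\<alpha> \<in> Hdual smul H \<Longrightarrow> tvec B H (rat_scale q \<alpha>) = smul (of_rat q) (tvec B H \<alpha>)"
  using tvec_scale by (simp add: rat_scale_def)

lemma hform_sym: "hform B H \<alpha> \<beta> = hform B H \<beta> \<alpha>"
  by (simp add: hform_def B_sym)

lemma roots_mod_isotropic:
  assumes "\<exists>\<alpha>0\<in>rootsx smul br B H. hform B H \<alpha>0 \<alpha>0 = 1"
  obtains P where "finite P" "P \<subseteq> roots smul br H"
    and "\<And>\<gamma>. \<gamma> \<in> rootsx smul br B H \<Longrightarrow> \<exists>\<gamma>'\<in>P. \<exists>\<delta>\<in>roots0 smul br B H. \<gamma> = \<gamma>' + \<delta>"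
proof -
  interpret rd: root_datum smul B troots by (rule root_datum_troots[OF assms])
  obtain P where P: "finite P" "P \<subseteq> {t \<in> troots. B t t \<noteq> 0}"
    "\<And>\<gamma>. \<gamma> \<in> troots \<Longrightarrow> B \<gamma> \<gamma> \<noteq> 0 \<Longrightarrow> \<exists>\<gamma>'\<in>P. \<gamma> - \<gamma>' \<in> troots \<and> B (\<gamma> - \<gamma>') (\<gamma> - \<gamma>') = 0"
    by (fact rd.finite_mod_isotropic)
  obtain P' where P': "P' \<subseteq> roots smul br H" "finite P'" "P = tvec B H ` P'"
    using finite_subset_image[OF P(1), of "tvec B H" "roots smul br H"] P(2) unfolding troots_def by auto
  show ?thesis
  proof (rule that[OF P'(2,1)])
    fix \<gamma> assume \<gamma>: "\<gamma> \<in> rootsx smul br B H"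
    hence \<gamma>R: "\<gamma> \<in> roots smul br H" by (simp add: rootsx_def)
    have "tvec B H \<gamma> \<in> troots" "B (tvec B H \<gamma>) (tvec B H \<gamma>) \<noteq> 0"
      using \<gamma> by (auto simp: rootsx_def hform_def troots_def)
    from P(3)[OF this] obtain \<gamma>' where \<gamma>': "\<gamma>' \<in> P'" "tvec B H \<gamma> - tvec B H \<gamma>' \<in> troots"
      "B (tvec B H \<gamma> - tvec B H \<gamma>') (tvec B H \<gamma> - tvec B H \<gamma>') = 0"
      unfolding P'(3) by blast
    then obtain \<delta> where \<delta>: "\<delta> \<in> roots smul br H" "tvec B H \<gamma> - tvec B H \<gamma>' = tvec B H \<delta>"
      unfolding troots_def by blast
    have \<gamma>'R: "\<gamma>' \<in> roots smul br H" using \<gamma>'(1) P'(1) by blast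
    have "\<gamma> = \<gamma>' + \<delta>"
    proof (rule tvec_inject)
      show "\<gamma> \<in> Hdual smul H" by (rule roots_Hdual[OF \<gamma>R])
      show "\<gamma>' + \<delta> \<in> Hdual smul H"
        using Hdual_add[OF roots_Hdual[OF \<gamma>'R] roots_Hdual[OF \<delta>(1)]] by (simp add: plus_fun_def)
      show "tvec B H \<gamma> = tvec B H (\<gamma>' + \<delta>)"
        using \<delta>(2) tvec_plus[OF roots_Hdual[OF \<gamma>'R] roots_Hdual[OF \<delta>(1)]] by (simp add: algebra_simps)
    qed
    moreover have "\<delta> \<in> roots0 smul br B H" using \<delta> \<gamma>'(3) by (simp add: roots0_def hform_def)
    ultimately show "\<exists>\<gamma>'\<in>P'. \<exists>\<delta>\<in>roots0 smul br B H. \<gamma> = \<gamma>' + \<delta>" using \<gamma>'(1) by blast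
  qed
qed

text \<open>Rational independence is the essential clause: it makes the image of \<open>X\<close>
  under a scalar extension independent over the reals, hence the isotropic lattice discrete. A
  finitely generated subgroup of a real space may be dense, as are the integer combinations of 1 and
  the square root of 2.\<close>

lemma isotropic_basis:
  obtains X where "finite X" "X \<subseteq> VQ" "roots0 smul br B H \<subseteq> int_span X" "rat_indep X"
proof -
  obtain X where X: "finite X" "X \<subseteq> int_span (roots0 smul br B H)"
    "int_span X = int_span (roots0 smul br B H)"
    and indep: "\<forall>c. (\<lambda>h. \<Sum>b\<in>X. of_int (c b) * b h) = (\<lambda>h. 0) \<longrightarrow> (\<forall>b\<in>X. c b = 0)"
    using isotropic_span unfolding free_abelian_finite_rank_def by (elim exE conjE) (rule that)
  have "rat_span (roots0 smul br B H) \<subseteq> VQ"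
    unfolding rat_span_eq_span by (intro ratfun.span_mono) (auto simp: roots0_def)
  hence "X \<subseteq> VQ" using X(2) int_span_subset_rat_span by blast
  moreover have "roots0 smul br B H \<subseteq> int_span X" unfolding X(3) by (auto intro: int_span_base)
  moreover have "rat_indep X" by (rule rat_indep_if_int_indep[OF X(1)]) (use indep in blast)
  ultimately show ?thesis using that X(1) by blast
qed

lemma roots_cases:
  assumes "\<gamma> \<in> roots smul br H"
  obtains "\<gamma> \<in> rootsx smul br B H" | "\<gamma> \<in> roots0 smul br B H"
  using assms by (auto simp: rootsx_def roots0_def)

text \<open>Finite dimension of \<open>H\<close> bounds only the span over the ground field, which
  may have infinite degree over the rationals. The generators are instead representatives
  \<open>P\<close> of the nonisotropic roots modulo isotropic ones, together with a basis
  \<open>X\<close> of the isotropic lattice.\<close>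

lemma finite_rat_span_roots:
  assumes norm: "\<exists>\<alpha>0\<in>rootsx smul br B H. hform B H \<alpha>0 \<alpha>0 = 1"
  shows "\<exists>S. finite S \<and> S \<subseteq> VQ \<and> rat_span S = VQ"
proof -
  obtain P where P: "finite P" "P \<subseteq> roots smul br H"
    "\<And>\<gamma>. \<gamma> \<in> rootsx smul br B H \<Longrightarrow> \<exists>\<gamma>'\<in>P. \<exists>\<delta>\<in>roots0 smul br B H. \<gamma> = \<gamma>' + \<delta>"
    using roots_mod_isotropic[OF norm] by blast
  obtain X where X: "finite X" "X \<subseteq> VQ" "roots0 smul br B H \<subseteq> int_span X"
    by (rule isotropic_basis) (rule that)
  have sub: "P \<union> X \<subseteq> VQ" using P(2) X(2) roots_VQ by blast
  have "rat_span X \<subseteq> rat_span (P \<union> X)" unfolding rat_span_eq_span by (intro ratfun.span_mono) simp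
  hence iso: "roots0 smul br B H \<subseteq> rat_span (P \<union> X)" using X(3) int_span_subset_rat_span by blast
  have "roots smul br H \<subseteq> ratfun.span (P \<union> X)"
  proof
    fix \<gamma> assume "\<gamma> \<in> roots smul br H"
    thus "\<gamma> \<in> ratfun.span (P \<union> X)"
    proof (cases rule: roots_cases)
      case 1
      then obtain \<gamma>' \<delta> where "\<gamma>' \<in> P" "\<delta> \<in> roots0 smul br B H" "\<gamma> = \<gamma>' + \<delta>" using P(3) by blast
      thus ?thesis using iso unfolding rat_span_eq_span
        by (metis UnI1 ratfun.span_add ratfun.span_base subsetD)
    next
      case 2
      thus ?thesis using iso unfolding rat_span_eq_span by blast
    qed
  qed
  hence "rat_span (P \<union> X) = VQ"
    using sub unfolding rat_span_eq_span
    by (metis ratfun.span_minimal ratfun.subspace_span subset_antisym)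
  thus ?thesis using P(1) X(1) sub by blast
qed

lemma hform_rat:
  assumes norm: "\<exists>\<alpha>0\<in>rootsx smul br B H. hform B H \<alpha>0 \<alpha>0 = 1"
    and "\<alpha> \<in> VQ" "\<beta> \<in> VQ"
  shows "\<exists>q. hform B H \<alpha> \<beta> = of_rat q"
proof -
  interpret rd: root_datum smul B troots by (rule root_datum_troots[OF norm])
  have sub: "ratfun.subspace {\<alpha> \<in> VQ. \<exists>q. hform B H \<alpha> \<beta> = of_rat q}" for \<beta>
  proof (rule ratfun.subspaceI)
    show "0 \<in> {\<alpha> \<in> VQ. \<exists>q. hform B H \<alpha> \<beta> = of_rat q}"
    proof -
      have "0 \<in> VQ" unfolding rat_span_eq_span by (rule ratfun.span_zero)
      moreover have "hform B H 0 \<beta> = of_rat 0"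
        using tvec_rat_scale[of 0 0] VQ_Hdual[OF \<open>0 \<in> VQ\<close>] by (simp add: hform_def B_zero_left)
      ultimately show ?thesis by blast
    qed
  next
    fix x y assume "x \<in> {\<alpha> \<in> VQ. \<exists>q. hform B H \<alpha> \<beta> = of_rat q}"
      "y \<in> {\<alpha> \<in> VQ. \<exists>q. hform B H \<alpha> \<beta> = of_rat q}"
    then obtain p q where *: "x \<in> VQ" "hform B H x \<beta> = of_rat p" "y \<in> VQ" "hform B H y \<beta> = of_rat q"
      by blast
    have "hform B H (x + y) \<beta> = of_rat (p + q)"
      using * tvec_plus[of x y] VQ_Hdual by (simp add: hform_def B_add_left of_rat_add)
    moreover have "x + y \<in> VQ" using * unfolding rat_span_eq_span by (intro ratfun.span_add)
    ultimately show "x + y \<in> {\<alpha> \<in> VQ. \<exists>q. hform B H \<alpha> \<beta> = of_rat q}" by blast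
  next
    fix c x assume "x \<in> {\<alpha> \<in> VQ. \<exists>q. hform B H \<alpha> \<beta> = of_rat q}"
    then obtain p where *: "x \<in> VQ" "hform B H x \<beta> = of_rat p" by blast
    have "hform B H (rat_scale c x) \<beta> = of_rat (c * p)"
      using * tvec_rat_scale[of x] VQ_Hdual by (simp add: hform_def B_smul_left of_rat_mult)
    moreover have "rat_scale c x \<in> VQ" using * unfolding rat_span_eq_span by (intro ratfun.span_scale)
    ultimately show "rat_scale c x \<in> {\<alpha> \<in> VQ. \<exists>q. hform B H \<alpha> \<beta> = of_rat q}" by blast
  qed
  \<comment> \<open>Extends rationality from roots to \<open>VQ\<close> in the first argument;
    symmetry of the form then handles the second.\<close>
  have extend: "\<exists>q. hform B H \<alpha> \<beta> = of_rat q"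
    if "\<alpha> \<in> VQ" "\<And>\<gamma>. \<gamma> \<in> roots smul br H \<Longrightarrow> \<exists>q. hform B H \<gamma> \<beta> = of_rat q" for \<alpha> \<beta>
  proof -
    have "ratfun.span (roots smul br H) \<subseteq> {\<alpha> \<in> VQ. \<exists>q. hform B H \<alpha> \<beta> = of_rat q}"
      using that(2) roots_VQ by (intro ratfun.span_minimal sub) blast
    thus ?thesis using that(1) unfolding rat_span_eq_span by blast
  qed
  have "\<exists>q. hform B H \<gamma> \<gamma>' = of_rat q" if "\<gamma> \<in> roots smul br H" "\<gamma>' \<in> roots smul br H" for \<gamma> \<gamma>'
    using rd.form_rat that unfolding hform_def troots_def by blast
  hence "\<exists>q. hform B H \<alpha> \<gamma> = of_rat q" if "\<gamma> \<in> roots smul br H" for \<gamma>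
    using extend assms(2) that by blast
  thus ?thesis using extend[OF assms(3)] hform_sym by metis
qed

end

section \<open>Transfer to the real scalar extension\<close>

lemma ears_scalar_extension:
  fixes smul :: "'a::field_char_0 \<Rightarrow> 'l::ab_group_add \<Rightarrow> 'l"
    and \<iota> :: "('l \<Rightarrow> 'a) \<Rightarrow> 'v::euclidean_space" and BR :: "'v \<Rightarrow> 'v \<Rightarrow> real"
  assumes T: "class_T smul br B H"
    and norm: "\<exists>\<alpha>0\<in>rootsx smul br B H. hform B H \<alpha>0 \<alpha>0 = 1"
    and ext: "scalar_extension (rat_span (roots smul br H)) \<iota>" and bil: "bilinear BR"
    and compat: "\<And>\<alpha> \<beta> q. \<alpha> \<in> rat_span (roots smul br H) \<Longrightarrow> \<beta> \<in> rat_span (roots smul br H) \<Longrightarrow> hform B H \<alpha> \<beta> = of_rat q \<Longrightarrow>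
      BR (\<iota> \<alpha>) (\<iota> \<beta>) = real_of_rat q"
  shows "0 \<le> BR v v" "ears BR (\<iota> ` roots smul br H)"
proof -
  interpret T: class_T_algebra smul br B H by unfold_locales (rule T)
  let ?R = "roots smul br H"
  interpret rd: root_datum smul B T.troots by (rule T.root_datum_troots[OF norm])
  have \<iota>_add: "\<iota> (\<alpha> + \<beta>) = \<iota> \<alpha> + \<iota> \<beta>" if "\<alpha> \<in> T.VQ" "\<beta> \<in> T.VQ" for \<alpha> \<beta>
    using ext that unfolding scalar_extension_def plus_fun_def by blast
  have \<iota>_scale: "\<iota> (rat_scale q \<alpha>) = real_of_rat q *\<^sub>R \<iota> \<alpha>" if "\<alpha> \<in> T.VQ" for q \<alpha>
    using ext that unfolding scalar_extension_def rat_scale_def by blast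
  have VQ_0: "0 \<in> T.VQ" and VQ_scale: "\<And>q \<alpha>. \<alpha> \<in> T.VQ \<Longrightarrow> rat_scale q \<alpha> \<in> T.VQ"
    and VQ_add: "\<And>\<alpha> \<beta>. \<alpha> \<in> T.VQ \<Longrightarrow> \<beta> \<in> T.VQ \<Longrightarrow> \<alpha> + \<beta> \<in> T.VQ"
    unfolding rat_span_eq_span by (simp_all add: ratfun.span_zero ratfun.span_scale ratfun.span_add)
  have \<iota>_0: "\<iota> 0 = 0" using \<iota>_scale[OF VQ_0, of 0] by simp
  have \<iota>_sum: "\<iota> (\<Sum>b\<in>S. rat_scale (c b) b) = (\<Sum>b\<in>S. real_of_rat (c b) *\<^sub>R \<iota> b)"
    if "finite S" "S \<subseteq> T.VQ" for S c
  proof -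
    have "(\<Sum>b\<in>S. rat_scale (c b) b) \<in> T.VQ \<and>
        \<iota> (\<Sum>b\<in>S. rat_scale (c b) b) = (\<Sum>b\<in>S. real_of_rat (c b) *\<^sub>R \<iota> b)"
      using that by (induction S rule: finite_induct) (auto simp: VQ_0 \<iota>_0 \<iota>_add \<iota>_scale VQ_scale VQ_add)
    thus ?thesis ..
  qed
  \<comment> \<open>\<open>compat\<close> speaks only of rational values, so rationality of the form
    on \<open>VQ\<close> is what carries vanishing, and next the Cartan relations, from the ground
    field to the reals.\<close>
  have zero_iff: "BR (\<iota> \<alpha>) (\<iota> \<beta>) = 0 \<longleftrightarrow> hform B H \<alpha> \<beta> = 0" if "\<alpha> \<in> T.VQ" "\<beta> \<in> T.VQ" for \<alpha> \<beta>
  proof -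
    obtain q where q: "hform B H \<alpha> \<beta> = of_rat q" using T.hform_rat[OF norm \<open>\<alpha> \<in> T.VQ\<close> \<open>\<beta> \<in> T.VQ\<close>] by blast
    show ?thesis unfolding compat[OF that q] q by simp
  qed
  have cartan: "2 * BR (\<iota> \<beta>) (\<iota> \<alpha>) = of_int m * BR (\<iota> \<alpha>) (\<iota> \<alpha>)"
    if "\<alpha> \<in> T.VQ" "\<beta> \<in> T.VQ" "2 * hform B H \<beta> \<alpha> = of_int m * hform B H \<alpha> \<alpha>" for \<alpha> \<beta> m
  proof -
    obtain p where p: "hform B H \<beta> \<alpha> = of_rat p" using T.hform_rat[OF norm \<open>\<beta> \<in> T.VQ\<close> \<open>\<alpha> \<in> T.VQ\<close>] by blast
    obtain q where q: "hform B H \<alpha> \<alpha> = of_rat q" using T.hform_rat[OF norm \<open>\<alpha> \<in> T.VQ\<close> \<open>\<alpha> \<in> T.VQ\<close>] by blast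
    have "(of_rat (2 * p) :: 'a) = of_rat (of_int m * q)" using that(3) p q by (simp add: of_rat_mult)
    hence "2 * p = of_int m * q" by (simp only: of_rat_eq_iff)
    hence "real_of_rat (2 * p) = real_of_rat (of_int m * q)" by simp
    thus ?thesis using compat[OF that(2,1) p] compat[OF that(1,1) q] by (simp add: of_rat_mult)
  qed
  have spn: "span (\<iota> ` ?R) = UNIV"
  proof -
    have "ratfun.subspace {\<alpha> \<in> T.VQ. \<iota> \<alpha> \<in> span (\<iota> ` ?R)}"
      by (intro ratfun.subspaceI)
        (auto simp: VQ_0 \<iota>_0 VQ_add \<iota>_add VQ_scale \<iota>_scale span_zero span_add span_scale)
    hence "ratfun.span ?R \<subseteq> {\<alpha> \<in> T.VQ. \<iota> \<alpha> \<in> span (\<iota> ` ?R)}"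
      using T.roots_VQ by (intro ratfun.span_minimal) (auto intro: span_base)
    hence "\<iota> ` T.VQ \<subseteq> span (\<iota> ` ?R)" by (auto simp: rat_span_eq_span)
    hence "span (\<iota> ` T.VQ) \<subseteq> span (\<iota> ` ?R)" by (intro span_minimal subspace_span)
    moreover have "span (\<iota> ` T.VQ) = UNIV" using ext unfolding scalar_extension_def by blast
    ultimately show ?thesis by auto
  qed
  \<comment> \<open>Symmetry is inherited: \<open>BR\<close> and its flip are both bilinear and
    agree on the images of the roots, which span.\<close>
  have sym: "BR v w = BR w v" for v w
  proof -
    have "bilinear (\<lambda>v w. BR w v)" using bil unfolding bilinear_def by blast
    moreover have "BR x y = BR y x" if xy: "x \<in> \<iota> ` ?R" "y \<in> \<iota> ` ?R" for x y
    proof -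
      obtain \<alpha> \<beta> where *: "\<alpha> \<in> T.VQ" "\<beta> \<in> T.VQ" "x = \<iota> \<alpha>" "y = \<iota> \<beta>" using xy T.roots_VQ by blast
      obtain q where q: "hform B H \<alpha> \<beta> = of_rat q" using T.hform_rat[OF norm *(1,2)] by blast
      show ?thesis using compat[OF *(1,2) q] compat[OF *(2,1), of q] q T.hform_sym[of \<beta> \<alpha>] *(3,4) by simp
    qed
    ultimately show ?thesis
      using bilinear_eq[OF bil, of "\<lambda>v w. BR w v" UNIV "\<iota> ` ?R" UNIV "\<iota> ` ?R" v w] spn by auto
  qed
  have hB: "B (tvec B H \<alpha>) (tvec B H \<beta>) = hform B H \<alpha> \<beta>" for \<alpha> \<beta> by (simp add: hform_def)
  have troot: "tvec B H \<alpha> \<in> T.troots" if "\<alpha> \<in> ?R" for \<alpha> using that by (simp add: T.troots_def)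

  have datum: "root_datum (*\<^sub>R) BR (\<iota> ` ?R)"
  proof
    show "BR (x + y) z = BR x z + BR y z" "BR (c *\<^sub>R x) z = c * BR x z" for x y z c
      using bil by (simp_all add: bilinear_ladd bilinear_lmul)
    show "BR x y = BR y x" for x y by (rule sym)
    show "- a \<in> \<iota> ` ?R" if a: "a \<in> \<iota> ` ?R" for a
    proof -
      obtain \<alpha> where \<alpha>: "\<alpha> \<in> ?R" "a = \<iota> \<alpha>" using a by blast
      have Q: "rat_scale (-1) \<alpha> \<in> T.VQ" using VQ_scale T.roots_VQ[OF \<alpha>(1)] by blast
      have "tvec B H (rat_scale (-1) \<alpha>) = - tvec B H \<alpha>"
        using T.tvec_rat_scale[OF T.roots_Hdual[OF \<alpha>(1)], of "-1"] by simp
      hence "rat_scale (-1) \<alpha> \<in> ?R"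
        unfolding T.roots_iff[OF T.VQ_Hdual[OF Q]] using T.troots_neg[OF troot[OF \<alpha>(1)]] by simp
      moreover have "\<iota> (rat_scale (-1) \<alpha>) = - a" using \<iota>_scale[OF T.roots_VQ[OF \<alpha>(1)], of "-1"] \<alpha>(2) by simp
      ultimately show ?thesis by (metis imageI)
    qed
    show "\<exists>m::int. 2 * BR b a = of_int m * BR a a \<and> (\<forall>i. 0 \<le> i \<and> i \<le> m \<longrightarrow> b - of_int i *\<^sub>R a \<in> \<iota> ` ?R)"
      if ab: "a \<in> \<iota> ` ?R" "BR a a \<noteq> 0" "b \<in> \<iota> ` ?R" for a b
    proof -
      obtain \<alpha> where \<alpha>: "\<alpha> \<in> ?R" "a = \<iota> \<alpha>" using ab by blast
      obtain \<beta> where \<beta>: "\<beta> \<in> ?R" "b = \<iota> \<beta>" using ab by blast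
      note aQ = T.roots_VQ[OF \<alpha>(1)] and bQ = T.roots_VQ[OF \<beta>(1)]
      have nz: "B (tvec B H \<alpha>) (tvec B H \<alpha>) \<noteq> 0" using ab(2) zero_iff[OF aQ aQ] \<alpha>(2) hB by simp
      obtain m where m: "2 * hform B H \<beta> \<alpha> = of_int m * hform B H \<alpha> \<alpha>"
        and desc: "\<forall>i. 0 \<le> i \<and> i \<le> m \<longrightarrow> tvec B H \<beta> - smul (of_int i) (tvec B H \<alpha>) \<in> T.troots"
        using T.troots_descend[OF troot[OF \<alpha>(1)] nz troot[OF \<beta>(1)]] unfolding hB by blast
      have "b - of_int i *\<^sub>R a \<in> \<iota> ` ?R" if i: "0 \<le> i" "i \<le> m" for i
      proof -
        have Q: "rat_scale (of_int (- i)) \<alpha> \<in> T.VQ" by (rule VQ_scale[OF aQ])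
        have "tvec B H (\<beta> + rat_scale (of_int (- i)) \<alpha>) = tvec B H \<beta> - smul (of_int i) (tvec B H \<alpha>)"
          using T.tvec_plus[OF T.VQ_Hdual[OF bQ] T.VQ_Hdual[OF Q]] T.tvec_rat_scale[OF T.VQ_Hdual[OF aQ], of "of_int (- i)"]
          by (simp add: of_rat_minus)
        hence "\<beta> + rat_scale (of_int (- i)) \<alpha> \<in> ?R"
          unfolding T.roots_iff[OF T.VQ_Hdual[OF VQ_add[OF bQ Q]]] using desc i by simp
        moreover have "\<iota> (\<beta> + rat_scale (of_int (- i)) \<alpha>) = b - of_int i *\<^sub>R a"
          using \<iota>_add[OF bQ Q] \<iota>_scale[OF aQ, of "of_int (- i)"] \<alpha>(2) \<beta>(2) by (simp add: of_rat_minus)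
        ultimately show ?thesis by (metis imageI)
      qed
      moreover have "2 * BR b a = of_int m * BR a a" using cartan[OF aQ bQ m] \<alpha>(2) \<beta>(2) by simp
      ultimately show ?thesis by blast
    qed
    show "BR d b = 0" if db: "d \<in> \<iota> ` ?R" "BR d d = 0" "b \<in> \<iota> ` ?R" for d b
    proof -
      obtain \<delta> \<beta> where *: "\<delta> \<in> ?R" "d = \<iota> \<delta>" "\<beta> \<in> ?R" "b = \<iota> \<beta>" using db by blast
      have "hform B H \<delta> \<delta> = 0" using db(2) zero_iff[of \<delta> \<delta>] T.roots_VQ * by simp
      hence "hform B H \<delta> \<beta> = 0" using T.isotropic_orthogonal[OF troot[OF *(1)] _ troot[OF *(3)]] by (simp add: hB)
      thus ?thesis using zero_iff[of \<delta> \<beta>] T.roots_VQ * by simp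
    qed
    show "\<not> (\<exists>A C. A \<noteq> {} \<and> C \<noteq> {} \<and> A \<inter> C = {} \<and> A \<union> C = {a \<in> \<iota> ` ?R. BR a a \<noteq> 0}
        \<and> (\<forall>a\<in>A. \<forall>c\<in>C. BR a c = 0))"
    proof (intro notI, elim exE conjE)
      fix A C assume AC: "A \<noteq> {}" "C \<noteq> {}" "A \<inter> C = {}" "A \<union> C = {a \<in> \<iota> ` ?R. BR a a \<noteq> 0}"
        and orth: "\<forall>a\<in>A. \<forall>c\<in>C. BR a c = 0"
      let ?p = "\<lambda>A. {\<alpha> \<in> ?R. \<iota> \<alpha> \<in> A}"
      have "A \<subseteq> \<iota> ` ?R" "C \<subseteq> \<iota> ` ?R" using AC(4) by auto
      hence "?p A \<noteq> {}" "?p C \<noteq> {}" using AC(1,2) by blast+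
      moreover have "?p A \<inter> ?p C = {}" using AC(3) by blast
      moreover have "?p A \<union> ?p C = rootsx smul br B H"
      proof -
        have "?p A \<union> ?p C = {\<alpha> \<in> ?R. \<iota> \<alpha> \<in> A \<union> C}" by blast
        also have "\<dots> = {\<alpha> \<in> ?R. BR (\<iota> \<alpha>) (\<iota> \<alpha>) \<noteq> 0}" unfolding AC(4) by blast
        also have "\<dots> = rootsx smul br B H" using zero_iff T.roots_VQ by (auto simp: rootsx_def)
        finally show ?thesis .
      qed
      moreover have "\<forall>a\<in>?p A. \<forall>c\<in>?p C. hform B H a c = 0" using orth zero_iff T.roots_VQ by blast
      ultimately show False by (rule T.roots_not_decomposable)
    qed
    show "\<exists>a\<in>\<iota> ` ?R. BR a a \<noteq> 0 \<and> a + d \<in> \<iota> ` ?R" if d: "d \<in> \<iota> ` ?R" "BR d d = 0" for d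
    proof -
      obtain \<delta> where \<delta>: "\<delta> \<in> ?R" "d = \<iota> \<delta>" using d by blast
      have "\<delta> \<in> roots0 smul br B H" using \<delta> d(2) zero_iff[of \<delta> \<delta>] T.roots_VQ by (simp add: roots0_def)
      then obtain \<alpha> where \<alpha>: "\<alpha> \<in> rootsx smul br B H" "\<alpha> + \<delta> \<in> ?R"
        using T.roots_nonisolated unfolding plus_fun_def by blast
      hence \<alpha>R: "\<alpha> \<in> ?R" "hform B H \<alpha> \<alpha> \<noteq> 0" by (auto simp: rootsx_def)
      have "BR (\<iota> \<alpha>) (\<iota> \<alpha>) \<noteq> 0" using \<alpha>R zero_iff[of \<alpha> \<alpha>] T.roots_VQ by simp
      moreover have "\<iota> \<alpha> + d \<in> \<iota> ` ?R" using \<alpha>(2) \<iota>_add[of \<alpha> \<delta>] T.roots_VQ \<alpha>R(1) \<delta> by (metis imageI)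
      ultimately show ?thesis using \<alpha>R(1) by blast
    qed
    show "\<exists>a\<in>\<iota> ` ?R. BR a a = 1"
    proof -
      obtain \<alpha> where "\<alpha> \<in> rootsx smul br B H" "hform B H \<alpha> \<alpha> = 1" using norm by blast
      hence "\<alpha> \<in> ?R" "hform B H \<alpha> \<alpha> = of_rat 1" by (auto simp: rootsx_def)
      thus ?thesis using compat[of \<alpha> \<alpha> 1] T.roots_VQ by auto
    qed
    show "\<exists>S. finite S \<and> \<iota> ` ?R \<subseteq> module.span (*\<^sub>R) S"
      by (intro exI[of _ Basis]) (simp flip: span_raw_def)
  qed
  interpret rv: root_datum "(*\<^sub>R)" BR "\<iota> ` ?R" by (rule datum)
  have psd: "0 \<le> BR v v" for v by (rule root_datum_positive_semidefinite[OF datum spn])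
  thus "0 \<le> BR v v" .

  obtain P where P: "finite P" "P \<subseteq> ?R"
    "\<And>\<gamma>. \<gamma> \<in> rootsx smul br B H \<Longrightarrow> \<exists>\<gamma>'\<in>P. \<exists>\<delta>\<in>roots0 smul br B H. \<gamma> = \<gamma>' + \<delta>"
    by (rule T.roots_mod_isotropic[OF norm]) (rule that)
  obtain X where X: "finite X" "X \<subseteq> T.VQ" "roots0 smul br B H \<subseteq> int_span X" "rat_indep X"
    by (rule T.isotropic_basis)
  have \<iota>X: "inj_on \<iota> X" "independent (\<iota> ` X)"
    using ext X unfolding scalar_extension_def by blast+
  define L where "L = {\<Sum>b\<in>\<iota> ` X. of_int (c b) *\<^sub>R b | c :: 'v \<Rightarrow> int. True}"
  have \<iota>L: "\<iota> \<delta> \<in> L" if \<delta>: "\<delta> \<in> roots0 smul br B H" for \<delta>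
  proof -
    obtain S c where S: "finite S" "S \<subseteq> X" "\<delta> = (\<lambda>h. \<Sum>b\<in>S. of_int (c b) * b h)"
      using X(3) \<delta> unfolding int_span_def by blast
    have "\<delta> = (\<Sum>b\<in>S. rat_scale (of_int (c b)) b)" unfolding S(3) sum_rat_scale by simp
    hence "\<iota> \<delta> = (\<Sum>b\<in>S. of_int (c b) *\<^sub>R \<iota> b)" using \<iota>_sum[of S] S(1,2) X(2) by auto
    \<comment> \<open>Coefficients outside \<open>S\<close> default to 0, and the inverse of \<iota>
      on \<open>X\<close> turns them into coefficients indexed by the image of \<open>X\<close>, as
      \<open>L\<close> demands.\<close>
    also have "\<dots> = (\<Sum>b\<in>X. of_int (if b \<in> S then c b else 0) *\<^sub>R \<iota> b)"
      using S(2) X(1) by (intro sum.mono_neutral_cong_left) auto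
    also have "\<dots> = (\<Sum>v\<in>\<iota> ` X. of_int (if inv_into X \<iota> v \<in> S then c (inv_into X \<iota> v) else 0) *\<^sub>R v)"
      unfolding sum.reindex[OF \<iota>X(1)] using inv_into_f_f[OF \<iota>X(1)] by (intro sum.cong) auto
    finally show ?thesis
      unfolding L_def by (intro CollectI exI[of _ "\<lambda>v. if inv_into X \<iota> v \<in> S then c (inv_into X \<iota> v) else 0"] conjI TrueI)
  qed
  obtain e where e: "e > 0" "\<And>c :: 'v \<Rightarrow> int. (\<Sum>b\<in>\<iota> ` X. of_int (c b) *\<^sub>R b) \<noteq> 0 \<Longrightarrow>
      e \<le> norm (\<Sum>b\<in>\<iota> ` X. of_int (c b) *\<^sub>R b)"
    using independent_int_combinations_separated[OF \<iota>X(2)] by blast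
  have sep: "e \<le> dist x y" if "x \<in> L" "y \<in> L" "x \<noteq> y" for x y
  proof -
    obtain c c' where *: "x = (\<Sum>b\<in>\<iota> ` X. of_int (c b) *\<^sub>R b)" "y = (\<Sum>b\<in>\<iota> ` X. of_int (c' b) *\<^sub>R b)"
      using \<open>x \<in> L\<close> \<open>y \<in> L\<close> unfolding L_def by blast
    have eq: "x - y = (\<Sum>b\<in>\<iota> ` X. of_int (c b - c' b) *\<^sub>R b)"
      unfolding * by (simp add: sum_subtractf scaleR_diff_left)
    show ?thesis
      using e(2)[of "\<lambda>b. c b - c' b"] \<open>x \<noteq> y\<close> unfolding eq[symmetric] dist_norm by simp
  qed
  \<comment> \<open>Nonisotropic roots lie in the cosets of the images of \<open>P\<close>; the
    added 0 takes care of the isotropic ones, which lie in \<open>L\<close> itself.\<close>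
  have cover: "\<exists>p\<in>insert 0 (\<iota> ` P). x - p \<in> L" if x: "x \<in> \<iota> ` ?R" for x
  proof -
    obtain \<gamma> where \<gamma>: "\<gamma> \<in> ?R" "x = \<iota> \<gamma>" using x by blast
    from \<gamma>(1) show ?thesis
    proof (cases rule: T.roots_cases)
      case 1
      then obtain \<gamma>' \<delta> where *: "\<gamma>' \<in> P" "\<delta> \<in> roots0 smul br B H" "\<gamma> = \<gamma>' + \<delta>" using P(3) by blast
      have "\<gamma>' \<in> T.VQ" "\<delta> \<in> T.VQ" using * P(2) T.roots_VQ by (auto simp: roots0_def)
      hence "x - \<iota> \<gamma>' = \<iota> \<delta>" using \<iota>_add \<gamma>(2) *(3) by simp
      hence "x - \<iota> \<gamma>' \<in> L" using \<iota>L[OF *(2)] by (simp only:)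
      thus ?thesis using *(1) by blast
    next
      case 2
      thus ?thesis using \<iota>L \<gamma>(2) by auto
    qed
  qed
  have discrete: "\<exists>d>0. \<forall>y\<in>\<iota> ` ?R. y \<noteq> x \<longrightarrow> d \<le> dist y x" for x
    by (rule finite_union_of_cosets_discrete[OF _ e(1) cover sep]) (use P(1) in auto)

  show "ears BR (\<iota> ` ?R)"
    unfolding ears_def
  proof (intro conjI)
    obtain a where a: "a \<in> \<iota> ` ?R" "BR a a = 1" using rv.R_normalized by blast
    show "\<iota> ` ?R \<noteq> {}" using a by blast
    have "a \<noteq> 0" using a(2) bilinear_lzero[OF bil] by auto
    thus "(UNIV :: 'v set) \<noteq> {0}" by auto
    show "\<forall>\<alpha>\<in>\<iota> ` ?R. BR \<alpha> \<alpha> \<noteq> 0 \<longrightarrow> (\<forall>\<beta>\<in>\<iota> ` ?R. \<exists>d u :: nat.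
           {\<beta> + of_int n *\<^sub>R \<alpha> | n. True} \<inter> \<iota> ` ?R
             = {\<beta> + of_int n *\<^sub>R \<alpha> | n. - int d \<le> n \<and> n \<le> int u}
         \<and> real d - real u = 2 * BR \<beta> \<alpha> / BR \<alpha> \<alpha>)"
    proof (intro ballI impI)
      fix \<alpha> \<beta> assume *: "\<alpha> \<in> \<iota> ` ?R" "BR \<alpha> \<alpha> \<noteq> 0" "\<beta> \<in> \<iota> ` ?R"
      obtain d u :: nat
        where iff: "\<And>n::int. \<beta> + of_int n *\<^sub>R \<alpha> \<in> \<iota> ` ?R \<longleftrightarrow> - int d \<le> n \<and> n \<le> int u"
          and du: "2 * BR \<beta> \<alpha> = (of_nat d - of_nat u) * BR \<alpha> \<alpha>"
        by (rule rv.string[OF *]) (rule that)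
      have "{\<beta> + of_int n *\<^sub>R \<alpha> | n. True} \<inter> \<iota> ` ?R = {\<beta> + of_int n *\<^sub>R \<alpha> | n. \<beta> + of_int n *\<^sub>R \<alpha> \<in> \<iota> ` ?R}"
        by blast
      hence "{\<beta> + of_int n *\<^sub>R \<alpha> | n. True} \<inter> \<iota> ` ?R = {\<beta> + of_int n *\<^sub>R \<alpha> | n. - int d \<le> n \<and> n \<le> int u}"
        unfolding iff .
      moreover have "real d - real u = 2 * BR \<beta> \<alpha> / BR \<alpha> \<alpha>" using du *(2) by simp
      ultimately show "\<exists>d u :: nat. {\<beta> + of_int n *\<^sub>R \<alpha> | n. True} \<inter> \<iota> ` ?R
             = {\<beta> + of_int n *\<^sub>R \<alpha> | n. - int d \<le> n \<and> n \<le> int u}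
         \<and> real d - real u = 2 * BR \<beta> \<alpha> / BR \<alpha> \<alpha>" by blast
    qed
    show "\<not> (\<exists>A C. A \<noteq> {} \<and> C \<noteq> {} \<and> A \<inter> C = {} \<and> A \<union> C = {\<alpha> \<in> \<iota> ` ?R. BR \<alpha> \<alpha> \<noteq> 0}
        \<and> (\<forall>a\<in>A. \<forall>c\<in>C. BR a c = 0))" by (rule rv.R_irreducible)
    show "\<forall>\<delta>\<in>\<iota> ` ?R. BR \<delta> \<delta> = 0 \<longrightarrow> (\<exists>\<alpha>\<in>\<iota> ` ?R. BR \<alpha> \<alpha> \<noteq> 0 \<and> \<alpha> + \<delta> \<in> \<iota> ` ?R)"
      using rv.R_isotropic_nonisolated by (intro ballI impI)
    show "\<forall>a\<in>\<iota> ` ?R. - a \<in> \<iota> ` ?R" using rv.R_neg by (intro ballI)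
    show "\<forall>x\<in>\<iota> ` ?R. \<exists>e>0. \<forall>y\<in>\<iota> ` ?R. y \<noteq> x \<longrightarrow> e \<le> dist y x" using discrete by (intro ballI)
    show "\<forall>u v. BR u v = BR v u" using sym by (intro allI)
    show "\<forall>v. 0 \<le> BR v v" using psd by (intro allI)
  qed (fact bil spn)+
qed

theorem theorem1p6:
  fixes smul :: "'a::field_char_0 \<Rightarrow> 'l::ab_group_add \<Rightarrow> 'l"
    and br :: "'l \<Rightarrow> 'l \<Rightarrow> 'l"
    and B :: "'l \<Rightarrow> 'l \<Rightarrow> 'a"
    and H :: "'l set"
  assumes T: "class_T smul br B H"
    and norm: "\<exists>\<alpha>0\<in>rootsx smul br B H. hform B H \<alpha>0 \<alpha>0 = 1"
  shows "(\<exists>S. finite S \<and> S \<subseteq> rat_span (roots smul br H)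
              \<and> rat_span S = rat_span (roots smul br H))
       \<and> (\<forall>\<alpha>\<in>rat_span (roots smul br H). \<forall>\<beta>\<in>rat_span (roots smul br H).
              \<exists>q. hform B H \<alpha> \<beta> = of_rat q)
       \<and> (\<forall>(\<iota> :: ('l \<Rightarrow> 'a) \<Rightarrow> 'v::euclidean_space) (BR :: 'v \<Rightarrow> 'v \<Rightarrow> real).
            scalar_extension (rat_span (roots smul br H)) \<iota> \<and> bilinear BR
            \<and> (\<forall>\<alpha>\<in>rat_span (roots smul br H). \<forall>\<beta>\<in>rat_span (roots smul br H). \<forall>q.
                  hform B H \<alpha> \<beta> = of_rat q \<longrightarrow> BR (\<iota> \<alpha>) (\<iota> \<beta>) = real_of_rat q)
            \<longrightarrow> (\<forall>v. 0 \<le> BR v v) \<and> ears BR (\<iota> ` roots smul br H))"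
proof -
  interpret T: class_T_algebra smul br B H by unfold_locales (rule T)
  show ?thesis
  proof (intro conjI allI impI ballI T.finite_rat_span_roots[OF norm] T.hform_rat[OF norm]; (elim conjE)?)
    fix \<iota> :: "('l \<Rightarrow> 'a) \<Rightarrow> 'v" and BR :: "'v \<Rightarrow> 'v \<Rightarrow> real"
    assume ext: "scalar_extension T.VQ \<iota>" "bilinear BR"
      and compat: "\<forall>\<alpha>\<in>T.VQ. \<forall>\<beta>\<in>T.VQ. \<forall>q. hform B H \<alpha> \<beta> = of_rat q \<longrightarrow> BR (\<iota> \<alpha>) (\<iota> \<beta>) = real_of_rat q"
    have "BR (\<iota> \<alpha>) (\<iota> \<beta>) = real_of_rat q" if "\<alpha> \<in> T.VQ" "\<beta> \<in> T.VQ" "hform B H \<alpha> \<beta> = of_rat q" for \<alpha> \<beta> q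
      using compat that by simp
    note ears = ears_scalar_extension[OF T norm ext this]
    show "0 \<le> BR v v" for v by (rule ears(1))
    show "ears BR (\<iota> ` roots smul br H)" by (rule ears(2))
  qed
qed

end
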